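(* There is an absolute constant $c > 0$ ($c \approx 0.043$) such that for every integer $r \ge 2$ and every online algorithm that $r$-colors the edges of the online random edge process on $n$ vertices, with high probability, after $(c \log_2 r) n$ rounds some color class still has all its connected components of order $O(\log n)$. For $r = 2$, the same conclusion holds after $c' n$ rounds for any constant $c' < 2 - \sqrt{2}$.
   Context: Online random edge process: there are $n$ vertices and a sequence of rounds; in each round one edge arrives, chosen uniformly at random among all pairs of distinct vertices, independently of previous rounds (repetitions are possible). The algorithm must color each edge with one of $r$ colors upon arrival, using only the history so far. "With high probability" means with probability tending to $1$ as $n\to\infty$. *)

theory Defs
  imports "HOL-Probability.Probability"
begin

type_synonym edge = "nat set"

text \<open>A history lists the rounds played so far, oldest first, each as the edge that arrived
  together with the colour it received.\<close>

type_synonym history = "(edge \<times> nat) list"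

text \<open>An online algorithm sees the history and the arriving edge and answers with a distribution
  on colours; deterministic algorithms are the case of point masses.\<close>

type_synonym algorithm = "history \<Rightarrow> edge \<Rightarrow> nat pmf"

definition uses_colours :: "nat \<Rightarrow> algorithm \<Rightarrow> bool" where
  "uses_colours r A \<longleftrightarrow> (\<forall>h e. set_pmf (A h e) \<subseteq> {..<r})"

definition vertex_pairs :: "nat \<Rightarrow> edge set" where
  "vertex_pairs n = {e. e \<subseteq> {..<n} \<and> card e = 2}"

text \<open>Meaningful for \<open>n \<ge> 2\<close> only: for smaller \<open>n\<close> the set of pairs is empty and
  \<open>pmf_of_set\<close> is unspecified.\<close>

primrec coloured_process :: "nat \<Rightarrow> algorithm \<Rightarrow> nat \<Rightarrow> history pmf" where
  "coloured_process n A 0 = return_pmf []"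
| "coloured_process n A (Suc m) =
     bind_pmf (coloured_process n A m) (\<lambda>h.
     bind_pmf (pmf_of_set (vertex_pairs n)) (\<lambda>e.
     bind_pmf (A h e) (\<lambda>k. return_pmf (h @ [(e, k)]))))"

definition colour_adj :: "history \<Rightarrow> nat \<Rightarrow> (nat \<times> nat) set" where
  "colour_adj h k = {(u, v). ({u, v}, k) \<in> set h}"

text \<open>Each colour class is a spanning graph on \<open>{..<n}\<close>, so vertices that meet no edge of the
  colour form components of order one.\<close>

definition colour_components :: "nat \<Rightarrow> history \<Rightarrow> nat \<Rightarrow> nat set set" where
  "colour_components n h k = (\<lambda>v. (colour_adj h k)\<^sup>* `` {v}) ` {..<n}"

definition some_colour_small :: "nat \<Rightarrow> nat \<Rightarrow> real \<Rightarrow> history \<Rightarrow> bool" where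
  "some_colour_small n r s h \<longleftrightarrow>
     (\<exists>k<r. \<forall>C\<in>colour_components n h k. real (card C) \<le> s)"

text \<open>The algorithm may be chosen separately for each \<open>n\<close>. The constant \<open>K\<close> hidden in
  \<open>O(log n)\<close> depends on \<open>r\<close> and \<open>t\<close>, not on the algorithm.\<close>

definition whp_small_colour_after :: "nat \<Rightarrow> real \<Rightarrow> bool" where
  "whp_small_colour_after r t \<longleftrightarrow>
     (\<exists>K::real. \<forall>A :: nat \<Rightarrow> algorithm. (\<forall>n. uses_colours r (A n)) \<longrightarrow>
        ((\<lambda>n. measure_pmf.prob (coloured_process n (A n) (nat \<lfloor>t * real n\<rfloor>))
                {h. some_colour_small n r (K * ln (real n)) h}) \<longlonglongrightarrow> 1))"

end

theory Submission
  imports Defs "HOL-Real_Asymp.Real_Asymp"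
begin

text \<open>Let \<open>s\<close> be the mean size of the component of a vertex in a graph. Adding \<open>t n\<close> random edges to it
  brings \<open>s\<close> to about \<open>s / (1 - 2 t s)\<close>, with exponentially decaying component sizes, as long as
  \<open>2 t s < 1\<close>; an algorithm that discards some of the edges only does worse. Split the colours of the
  graph into two halves. Pairs of vertices connected in one half are (up to the few cycles of the
  graph) not connected in the other, so one half has mean component size at most about
  \<open>(1 + s / (1 - 2 t s)) / 2\<close>. Keep that half and repeat. For \<open>t < (3 - 2 sqrt 2) / 2 = 0.0857...\<close> the
  map \<open>s \<mapsto> (1 + s / (1 - 2 t s)) / 2\<close> has a fixed point, so that about \<open>log 2 r\<close> phases can be
  survived before only one colour is left. Two colours allow two phases of any length
  \<open>t < 1 - sqrt 2 / 2\<close>.\<close>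

section \<open>Components under edge insertion\<close>

text \<open>An edge joining components of sizes a and b adds 2ab to the sum over vertices of the
  component size, so the mean obeys at worst s' = 2 s^2, whose solution is s / (1 - 2 t s). The
  algorithm is adaptive and may be randomised, so the coloured graph offers no independence; every
  estimate is a one-step drift bound valid for each colour of the arriving edge. The mean alone does
  not close, since its fluctuations depend on the larger components. Exponential moments do close,
  but each phase spends part of the exponent \<beta>. Two facts survive a phase: some exponential
  moment is bounded, with unspecified constants, and the mean has a sharp bound. The next phase
  restarts at a much smaller exponent, where the mean again determines the exponential moment. Which
  half is kept depends on the history, so a phase is analysed for every fixed group and the failure
  probabilities are summed over the finitely many groups of that depth, the residue classes of
  colours modulo a power of two.\<close>

definition component :: "(nat \<times> nat) set \<Rightarrow> nat \<Rightarrow> nat set" where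
  "component R v = R\<^sup>* `` {v}"

lemma component_self: "v \<in> component R v"
  by (simp add: component_def)

lemma component_mono: "R \<subseteq> S \<Longrightarrow> component R v \<subseteq> component S v"
  unfolding component_def using rtrancl_mono by blast

lemma component_eq:
  assumes "sym R" "w \<in> component R v"
  shows "component R w = component R v"
proof -
  have "(v, w) \<in> R\<^sup>*" "(w, v) \<in> R\<^sup>*"
    using assms sym_rtrancl[OF assms(1)] by (auto simp: component_def dest: symD)
  then show ?thesis
    unfolding component_def by (auto intro: rtrancl_trans)
qed

lemma component_subset:
  assumes "R \<subseteq> V \<times> V" "v \<in> V"
  shows "component R v \<subseteq> V"
proof
  fix w assume "w \<in> component R v"
  then have "(v, w) \<in> R\<^sup>*" by (simp add: component_def)
  then show "w \<in> V" by (induction) (use assms in auto)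
qed

lemma component_closed:
  assumes "v \<in> S" "\<And>x y. x \<in> S \<Longrightarrow> (x, y) \<in> R \<Longrightarrow> y \<in> S"
  shows "component R v \<subseteq> S"
proof
  fix w assume "w \<in> component R v"
  then have "(v, w) \<in> R\<^sup>*" by (simp add: component_def)
  then show "w \<in> S" by (induction) (use assms in auto)
qed

lemma component_step: "x \<in> component R v \<Longrightarrow> (x, y) \<in> R \<Longrightarrow> y \<in> component R v"
  unfolding component_def by (auto intro: rtrancl_into_rtrancl)

lemma component_insert_edge:
  assumes "sym R"
  shows "component (R \<union> {(u, v), (v, u)}) w =
    (if w \<in> component R u \<union> component R v then component R u \<union> component R v
     else component R w)"
proof -
  let ?R = "R \<union> {(u, v), (v, u)}"
  have symR': "sym ?R" using assms by (auto simp: sym_def)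
  have sub: "component R x \<subseteq> component ?R x" for x by (rule component_mono) auto
  have uv: "component ?R u = component ?R v"
    by (rule component_eq[OF symR'])
       (auto intro: component_step[OF component_self])
  have disj: "w \<in> component R x" if "y \<in> component R w" "y \<in> component R x" for x y
    using component_eq[OF assms that(1)] component_eq[OF assms that(2)]
      component_self by metis
  show ?thesis
  proof (cases "w \<in> component R u \<union> component R v")
    case True
    then have eq: "component ?R w = component ?R u"
      using sub component_eq[OF symR'] uv by blast
    have "component ?R u \<subseteq> component R u \<union> component R v"
      by (rule component_closed) (auto intro: component_step component_self)
    then show ?thesis using True eq sub[of u] sub[of v] uv by auto
  next
    case False
    have "component ?R w \<subseteq> component R w"
    proof (rule component_closed)
      show "w \<in> component R w" by (rule component_self)
      fix x y assume "x \<in> component R w" "(x, y) \<in> ?R"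
      moreover have "x \<noteq> u" "x \<noteq> v"
        using False disj[of x] component_self \<open>x \<in> component R w\<close> by blast+
      ultimately show "y \<in> component R w" by (auto intro: component_step)
    qed
    then show ?thesis using False sub[of w] by auto
  qed
qed

text \<open>Colours are treated in groups: a set \<open>M\<close> of colours gives the graph of all edges with a
  colour in \<open>M\<close>.\<close>

definition group_adj :: "history \<Rightarrow> nat set \<Rightarrow> (nat \<times> nat) set" where
  "group_adj h M = {(u, v). \<exists>k\<in>M. ({u, v}, k) \<in> set h}"

definition csize :: "history \<Rightarrow> nat set \<Rightarrow> nat \<Rightarrow> nat" where
  "csize h M v = card (component (group_adj h M) v)"

definition valid_history :: "nat \<Rightarrow> history \<Rightarrow> bool" where
  "valid_history n h \<longleftrightarrow> fst ` set h \<subseteq> vertex_pairs n"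

definition linked :: "history \<Rightarrow> nat set \<Rightarrow> nat \<Rightarrow> nat \<Rightarrow> bool" where
  "linked h M u v \<longleftrightarrow> v \<in> component (group_adj h M) u"

lemma sym_group_adj: "sym (group_adj h M)"
  by (auto simp: sym_def group_adj_def insert_commute)

lemma group_adj_mono: "M \<subseteq> M' \<Longrightarrow> group_adj h M \<subseteq> group_adj h M'"
  by (auto simp: group_adj_def)

lemma group_adj_append:
  "group_adj (h @ [({u, v}, k)]) M =
     (if k \<in> M then group_adj h M \<union> {(u, v), (v, u)} else group_adj h M)"
  by (auto simp: group_adj_def doubleton_eq_iff)

lemma valid_append:
  "valid_history n h \<Longrightarrow> e \<in> vertex_pairs n \<Longrightarrow> valid_history n (h @ [(e, k)])"
  by (auto simp: valid_history_def)

lemma group_adj_subset: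
  assumes "valid_history n h"
  shows "group_adj h M \<subseteq> {..<n} \<times> {..<n}"
  using assms unfolding group_adj_def valid_history_def vertex_pairs_def by fastforce

context
  fixes n :: nat and h :: history
  assumes valid: "valid_history n h"
begin

lemma component_below: "v < n \<Longrightarrow> component (group_adj h M) v \<subseteq> {..<n}"
  using component_subset[OF group_adj_subset[OF valid]] by auto

lemma finite_component: "v < n \<Longrightarrow> finite (component (group_adj h M) v)"
  using component_below finite_subset by blast

lemma csize_mono: "v < n \<Longrightarrow> M \<subseteq> M' \<Longrightarrow> csize h M v \<le> csize h M' v"
  unfolding csize_def
  by (intro card_mono finite_component component_mono group_adj_mono)

lemma csize_linked: "linked h M u v \<Longrightarrow> csize h M v = csize h M u"
  unfolding csize_def linked_def using component_eq[OF sym_group_adj] by metis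

lemma linked_mono: "linked h M u v \<Longrightarrow> M \<subseteq> M' \<Longrightarrow> linked h M' u v"
  unfolding linked_def using component_mono[OF group_adj_mono] by blast

text \<open>A component of size c contributes c * f c to a sum over vertices, so a merge replaces a
  * f a + b * f b by (a + b) * f (a + b).\<close>

lemma sum_csize_merge:
  fixes f :: "nat \<Rightarrow> real"
  assumes uv: "u < n" "v < n" and k: "k \<in> M" and nl: "\<not> linked h M u v"
  defines "a \<equiv> csize h M u" and "b \<equiv> csize h M v"
  shows "(\<Sum>w<n. f (csize (h @ [({u, v}, k)]) M w)) =
    (\<Sum>w<n. f (csize h M w)) + (real (a + b) * f (a + b) - real a * f a - real b * f b)"
proof -
  let ?R = "group_adj h M"
  define C D where "C = component ?R u" and "D = component ?R v"
  have sub: "C \<subseteq> {..<n}" "D \<subseteq> {..<n}"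
    using component_below uv by (auto simp: C_def D_def)
  then have fin: "finite C" "finite D" using finite_subset by auto
  have disj: "C \<inter> D = {}"
  proof (rule ccontr)
    assume "C \<inter> D \<noteq> {}"
    then obtain x where "x \<in> C" "x \<in> D" by auto
    then have "C = D" using component_eq[OF sym_group_adj] unfolding C_def D_def by metis
    then show False using nl component_self unfolding C_def D_def linked_def by metis
  qed
  have card: "card (C \<union> D) = a + b" "card C = a" "card D = b"
    using card_Un_disjoint[OF fin disj] by (auto simp: a_def b_def csize_def C_def D_def)
  let ?c = "csize h M" and ?c' = "csize (h @ [({u, v}, k)]) M"
  have c': "?c' w = (if w \<in> C \<union> D then a + b else ?c w)" for w
    using k card component_insert_edge[OF sym_group_adj, of h M u v w]
    by (simp add: csize_def group_adj_append C_def D_def)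
  have cC: "?c w = a" if "w \<in> C" for w
    using component_eq[OF sym_group_adj] that card unfolding C_def csize_def by metis
  have cD: "?c w = b" if "w \<in> D" for w
    using component_eq[OF sym_group_adj] that card unfolding D_def csize_def by metis
  have split: "(\<Sum>w<n. g w) = (\<Sum>w\<in>{..<n} - (C \<union> D). g w) + (\<Sum>w\<in>C. g w) + (\<Sum>w\<in>D. g w)"
    for g :: "nat \<Rightarrow> real"
    using sum.subset_diff[of "C \<union> D" "{..<n}" g] sum.union_disjoint[OF fin disj, of g] sub by auto
  have "(\<Sum>w<n. f (?c' w)) = (\<Sum>w\<in>{..<n} - (C \<union> D). f (?c w)) + (\<Sum>w\<in>C. f (a+b)) + (\<Sum>w\<in>D. f (a+b))"
    unfolding split[of "\<lambda>w. f (?c' w)"] by (intro arg_cong2[where f="(+)"] sum.cong) (auto simp: c')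
  moreover have "(\<Sum>w<n. f (?c w)) = (\<Sum>w\<in>{..<n} - (C \<union> D). f (?c w)) + (\<Sum>w\<in>C. f a) + (\<Sum>w\<in>D. f b)"
    unfolding split[of "\<lambda>w. f (?c w)"] by (intro arg_cong2[where f="(+)"] sum.cong) (auto simp: cC cD)
  ultimately show ?thesis using card by (simp add: algebra_simps)
qed

lemma csize_append_linked:
  assumes "k \<notin> M \<or> linked h M u v"
  shows "csize (h @ [({u, v}, k)]) M w = csize h M w"
proof (cases "k \<in> M")
  case True
  then have eq: "component (group_adj h M) v = component (group_adj h M) u"
    using assms component_eq[OF sym_group_adj] unfolding linked_def by blast
  have "component (group_adj h M) w = component (group_adj h M) u"
    if "w \<in> component (group_adj h M) u"
    using that component_eq[OF sym_group_adj] by blast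
  then show ?thesis
    using component_insert_edge[OF sym_group_adj, of h M u v w] True eq
    by (auto simp: csize_def group_adj_append)
qed (simp add: csize_def group_adj_append)

text \<open>Here the colour drops out: an edge outside \<open>M\<close> or inside a component
  changes nothing, which \<open>0 \<le> D\<close> covers, and any other edge is a merge.\<close>

lemma sum_csize_append_le:
  fixes f :: "nat \<Rightarrow> real"
  assumes uv: "u < n" "v < n" and D: "0 \<le> D"
    "\<And>a b. a = csize h M u \<Longrightarrow> b = csize h M v \<Longrightarrow>
      real (a + b) * f (a + b) - real a * f a - real b * f b \<le> D"
  shows "(\<Sum>w<n. f (csize (h @ [({u, v}, k)]) M w)) \<le> (\<Sum>w<n. f (csize h M w)) + D"
proof (cases "k \<notin> M \<or> linked h M u v")
  case True
  show ?thesis unfolding csize_append_linked[OF True] using D by simp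
next
  case False
  then show ?thesis using sum_csize_merge[OF uv, of k M f] D(2)[OF refl refl] by simp
qed

lemma csize_le_append:
  assumes "u < n" "v < n" "u \<noteq> v" "w < n"
  shows "csize h M w \<le> csize (h @ [({u, v}, k)]) M w"
proof -
  have "valid_history n (h @ [({u, v}, k)])"
    by (rule valid_append[OF valid]) (use assms in \<open>auto simp: vertex_pairs_def\<close>)
  then have "finite (component (group_adj (h @ [({u, v}, k)]) M) w)"
    using component_subset[OF group_adj_subset] assms(4) finite_subset by (metis finite_lessThan lessThan_iff)
  then show ?thesis unfolding csize_def
    by (intro card_mono component_mono) (auto simp: group_adj_append)
qed

end
section \<open>Expectations along the process\<close>

lemma finite_vertex_pairs: "finite (vertex_pairs n)"
  unfolding vertex_pairs_def by (rule finite_subset[of _ "Pow {..<n}"]) auto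

lemma card_vertex_pairs: "2 * card (vertex_pairs n) = n * (n - 1)"
proof -
  have "card (vertex_pairs n) = n choose 2"
    unfolding vertex_pairs_def using n_subsets[of "{..<n}" 2] by simp
  then have "card (vertex_pairs n) = n * (n - 1) div 2" by (simp add: choose_two)
  moreover have "even (n * (n - 1))" by auto
  ultimately show ?thesis by (metis dvd_mult_div_cancel)
qed

lemma vertex_pairs_nonempty:
  assumes "n \<ge> 2"
  shows "vertex_pairs n \<noteq> {}"
proof -
  have "{0, 1} \<in> vertex_pairs n" using assms by (auto simp: vertex_pairs_def)
  then show ?thesis by blast
qed

text \<open>Each edge is counted in both orders. Over ordered pairs, a product of functions of the
  two endpoint components sums to a product of two \<open>csum\<close>s.\<close>

lemma sum_vertex_pairs:
  fixes G :: "edge \<Rightarrow> real"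
  shows "(\<Sum>u<n. \<Sum>v\<in>{..<n} - {u}. G {u, v}) = 2 * (\<Sum>e\<in>vertex_pairs n. G e)"
proof -
  let ?S = "SIGMA u:{..<n}. {..<n} - {u}"
  have fib: "card {p\<in>?S. {fst p, snd p} = e} = 2" if e: "e \<in> vertex_pairs n" for e
  proof -
    obtain a b where ab: "e = {a, b}" "a \<noteq> b" "a < n" "b < n"
      using e unfolding vertex_pairs_def by (auto simp: card_2_iff)
    have "{p\<in>?S. {fst p, snd p} = e} = {(a, b), (b, a)}"
      using ab by (auto simp: doubleton_eq_iff)
    then show ?thesis using ab by simp
  qed
  have "(\<Sum>u<n. \<Sum>v\<in>{..<n} - {u}. G {u, v}) = (\<Sum>p\<in>?S. G {fst p, snd p})"
    by (subst sum.Sigma) (auto simp: case_prod_beta)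
  also have "\<dots> = (\<Sum>e\<in>vertex_pairs n. \<Sum>p\<in>{p\<in>?S. {fst p, snd p} = e}. G {fst p, snd p})"
    by (rule sum.group[symmetric]) (auto simp: finite_vertex_pairs vertex_pairs_def)
  also have "\<dots> = (\<Sum>e\<in>vertex_pairs n. 2 * G e)"
    using fib by (intro sum.cong refl) simp
  finally show ?thesis by (simp add: sum_distrib_left)
qed

lemma set_pmf_process:
  assumes "n \<ge> 2" "h \<in> set_pmf (coloured_process n A m)"
  shows "length h = m \<and> valid_history n h"
  using assms(2)
proof (induction m arbitrary: h)
  case 0
  then show ?case by (simp add: valid_history_def)
next
  case (Suc m)
  then show ?case
    using set_pmf_of_set[OF vertex_pairs_nonempty[OF assms(1)] finite_vertex_pairs]
    by (auto simp: valid_append)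
qed

lemma integrable_unit_interval:
  fixes Z :: "'z \<Rightarrow> real"
  assumes "\<And>z. 0 \<le> Z z" "\<And>z. Z z \<le> 1"
  shows "integrable (measure_pmf p) Z"
  by (rule measure_pmf.integrable_const_bound[where B=1]) (use assms in auto)

lemma expectation_unit_interval:
  fixes Z :: "'z \<Rightarrow> real"
  assumes "\<And>z. 0 \<le> Z z" "\<And>z. Z z \<le> 1"
  shows "0 \<le> measure_pmf.expectation p Z" "measure_pmf.expectation p Z \<le> 1"
  using assms measure_pmf.integral_le_const[OF integrable_unit_interval, of Z 1 p]
  by (auto intro: integral_nonneg_AE)

lemma expectation_bind_unit_interval:
  fixes Z :: "'z \<Rightarrow> real" and p :: "'y pmf" and q :: "'y \<Rightarrow> 'z pmf"
  assumes "\<And>z. 0 \<le> Z z" "\<And>z. Z z \<le> 1"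
  shows "measure_pmf.expectation (bind_pmf p q) Z =
    measure_pmf.expectation p (\<lambda>y. measure_pmf.expectation (q y) Z)"
proof -
  note eZ = nn_integral_eq_integral[OF integrable_unit_interval, of Z, OF assms, symmetric]
  note bnd = expectation_unit_interval[of Z, OF assms]
  have "ennreal (measure_pmf.expectation (bind_pmf p q) Z) =
      (\<integral>\<^sup>+y. \<integral>\<^sup>+z. ennreal (Z z) \<partial>measure_pmf (q y) \<partial>measure_pmf p)"
    using eZ[of "bind_pmf p q"] assms by simp
  also have "\<dots> = (\<integral>\<^sup>+y. ennreal (measure_pmf.expectation (q y) Z) \<partial>measure_pmf p)"
    using eZ assms by simp
  also have "\<dots> = ennreal (measure_pmf.expectation p (\<lambda>y. measure_pmf.expectation (q y) Z))"
    using nn_integral_eq_integral[OF integrable_unit_interval[of "\<lambda>y. measure_pmf.expectation (q y) Z" p, OF bnd]] bnd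
    by simp
  finally show ?thesis
    using bnd by (subst (asm) ennreal_inj) (auto intro!: integral_nonneg_AE)
qed

text \<open>Bounding the value after the next round uniformly in the colour \<open>k\<close> removes the algorithm
  from the analysis.\<close>

lemma expectation_step:
  fixes X Y :: "history \<Rightarrow> real"
  assumes n: "n \<ge> 2"
    and X: "\<And>h. 0 \<le> X h" "\<And>h. X h \<le> 1" and Y: "\<And>h. 0 \<le> Y h" "\<And>h. Y h \<le> 1"
    and F: "\<And>h u v k. h \<in> set_pmf (coloured_process n A m) \<Longrightarrow> u < n \<Longrightarrow> v < n \<Longrightarrow> u \<noteq> v \<Longrightarrow>
        X (h @ [({u, v}, k)]) \<le> F h u v"
    and mean: "\<And>h. h \<in> set_pmf (coloured_process n A m) \<Longrightarrow>
        (\<Sum>u<n. \<Sum>v\<in>{..<n} - {u}. F h u v) \<le> real n * (real n - 1) * (Y h + c)"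
  shows "measure_pmf.expectation (coloured_process n A (Suc m)) X \<le>
         measure_pmf.expectation (coloured_process n A m) Y + c"
proof -
  let ?P = "coloured_process n A m" and ?E = "pmf_of_set (vertex_pairs n)"
  note int = integrable_unit_interval and bnd = expectation_unit_interval
  define H where "H h e = measure_pmf.expectation (A h e) (\<lambda>k. X (h @ [(e, k)]))" for h e
  have H: "0 \<le> H h e" "H h e \<le> 1" for h e
    unfolding H_def using bnd[of "\<lambda>k. X (h @ [(e, k)])" "A h e"] X by auto
  have "measure_pmf.expectation (coloured_process n A (Suc m)) X =
      measure_pmf.expectation ?P (\<lambda>h. measure_pmf.expectation ?E (H h))"
    unfolding coloured_process.simps H_def
    by (simp add: expectation_bind_unit_interval X H expectation_unit_interval)
  also have "\<dots> \<le> measure_pmf.expectation ?P (\<lambda>h. Y h + c)"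
  proof (rule integral_mono_AE)
    show "integrable ?P (\<lambda>h. measure_pmf.expectation ?E (H h))"
      by (rule int) (intro bnd H)+
    show "integrable ?P (\<lambda>h. Y h + c)" by (rule Bochner_Integration.integrable_add[OF int[of Y]]) (use Y in auto)
    have "measure_pmf.expectation ?E (H h) \<le> Y h + c" if h: "h \<in> set_pmf ?P" for h
    proof -
      have c: "2 * real (card (vertex_pairs n)) = real n * (real n - 1)"
        using arg_cong[OF card_vertex_pairs[of n], of real] n by simp
      have pos: "real n * (real n - 1) > 0" using n by auto
      have HF: "H h {u, v} \<le> F h u v" if "u < n" "v < n" "u \<noteq> v" for u v
        unfolding H_def using F[OF h that] by (intro measure_pmf.integral_le_const int) (use X in auto)
      have "measure_pmf.expectation ?E (H h) = (\<Sum>e\<in>vertex_pairs n. H h e) / card (vertex_pairs n)"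
        by (rule integral_pmf_of_set[OF vertex_pairs_nonempty[OF n] finite_vertex_pairs])
      also have "\<dots> = (2 * (\<Sum>e\<in>vertex_pairs n. H h e)) / (2 * real (card (vertex_pairs n)))"
        by simp
      also have "\<dots> = (\<Sum>u<n. \<Sum>v\<in>{..<n} - {u}. H h {u, v}) / (real n * (real n - 1))"
        unfolding c sum_vertex_pairs ..
      also have "\<dots> \<le> (\<Sum>u<n. \<Sum>v\<in>{..<n} - {u}. F h u v) / (real n * (real n - 1))"
        using HF pos by (intro divide_right_mono sum_mono) auto
      also have "\<dots> \<le> Y h + c"
        using mean[OF h] pos by (simp add: pos_divide_le_eq mult.commute)
      finally show ?thesis .
    qed
    then show "AE h in ?P. measure_pmf.expectation ?E (H h) \<le> Y h + c"
      by (simp add: AE_measure_pmf_iff)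
  qed
  also have "\<dots> = measure_pmf.expectation ?P Y + c"
    by (subst Bochner_Integration.integral_add) (use int[of Y] Y in auto)
  finally show ?thesis .
qed

lemma expectation_steps:
  fixes X :: "nat \<Rightarrow> history \<Rightarrow> real"
  assumes "m1 \<le> m2"
    and "\<And>m. m1 \<le> m \<Longrightarrow> m < m2 \<Longrightarrow>
      measure_pmf.expectation (coloured_process n A (Suc m)) (X (Suc m)) \<le>
      measure_pmf.expectation (coloured_process n A m) (X m) + c"
  shows "measure_pmf.expectation (coloured_process n A m2) (X m2) \<le>
      measure_pmf.expectation (coloured_process n A m1) (X m1) + real (m2 - m1) * c"
  using assms
proof (induction m2 rule: dec_induct)
  case (step m)
  then have "measure_pmf.expectation (coloured_process n A (Suc m)) (X (Suc m)) \<le>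
      measure_pmf.expectation (coloured_process n A m1) (X m1) + real (m - m1) * c + c"
    by force
  then show ?case using step by (simp add: Suc_diff_le algebra_simps)
qed simp

lemma prob_le_expectation:
  fixes X :: "history \<Rightarrow> real"
  assumes "\<And>h. 0 \<le> X h" "\<And>h. X h \<le> 1" "\<And>h. h \<in> set_pmf p \<Longrightarrow> h \<in> S \<Longrightarrow> X h = 1"
  shows "measure_pmf.prob p S \<le> measure_pmf.expectation p X"
proof -
  have "measure_pmf.prob p S = measure_pmf.expectation p (indicator S)" by simp
  also have "\<dots> \<le> measure_pmf.expectation p X"
    using assms
    by (intro integral_mono_AE measure_pmf.integrable_const_bound[where B=1])
       (auto simp: AE_measure_pmf_iff indicator_def)
  finally show ?thesis .
qed

text \<open>Rounds only append to the history. This carries a bound at the end of one phase over to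
  the process at the end of the next.\<close>

lemma take_process:
  assumes "n \<ge> 2" "m \<le> m'"
  shows "map_pmf (take m) (coloured_process n A m') = coloured_process n A m"
  using assms(2)
proof (induction m' rule: dec_induct)
  case base
  have "map_pmf (take m) (coloured_process n A m) = map_pmf id (coloured_process n A m)"
    by (rule map_pmf_cong) (use set_pmf_process[OF assms(1)] in auto)
  then show ?case by (simp add: pmf.map_id)
next
  case (step m')
  have "map_pmf (take m) (coloured_process n A (Suc m')) =
      bind_pmf (coloured_process n A m') (\<lambda>h. return_pmf (take m h))"
    using step set_pmf_process[OF assms(1)]
    by (auto simp: map_bind_pmf intro!: bind_pmf_cong)
  also have "\<dots> = map_pmf (take m) (coloured_process n A m')" by (simp add: map_pmf_def)
  finally show ?case using step by simp
qed
section \<open>Exponential moments of component sizes during one phase\<close>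

text \<open>Summing over vertices weights a component by its size: \<open>csum n h M real\<close> is
  the sum of the squared component sizes, that is, n times the susceptibility.\<close>

definition csum :: "nat \<Rightarrow> history \<Rightarrow> nat set \<Rightarrow> (nat \<Rightarrow> real) \<Rightarrow> real" where
  "csum n h M f = (\<Sum>w<n. f (csize h M w))"

text \<open>With the 1 subtracted, a merge increases the sum over vertices by exactly a * exp
  (\<beta> a) * expm b + b * exp (\<beta> b) * expm a. This product of the moment and its
  \<beta>-derivative is the source of Burgers' equation.\<close>

definition expm :: "real \<Rightarrow> nat \<Rightarrow> real" where
  "expm \<beta> a = exp (\<beta> * real a) - 1"

definition small_exp :: "real \<Rightarrow> real \<Rightarrow> nat \<Rightarrow> real" where
  "small_exp l \<beta> a = (if real a \<le> l then exp (\<beta> * real a) - 1 else 0)"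

definition large_exp :: "real \<Rightarrow> real \<Rightarrow> nat \<Rightarrow> real" where
  "large_exp l \<mu> a = (if real a \<le> l then 0 else exp (\<mu> * real a))"

lemma csum_mono: "(\<And>a. f a \<le> g a) \<Longrightarrow> csum n h M f \<le> csum n h M g"
  unfolding csum_def by (intro sum_mono) auto

lemma csum_nonneg: "(\<And>a. 0 \<le> f a) \<Longrightarrow> 0 \<le> csum n h M f"
  unfolding csum_def by (intro sum_nonneg) auto

lemma csum_add: "csum n h M (\<lambda>a. f a + g a) = csum n h M f + csum n h M g"
  unfolding csum_def by (rule sum.distrib)

lemma csum_cmult: "csum n h M (\<lambda>a. c * f a) = c * csum n h M f"
  unfolding csum_def by (rule sum_distrib_left[symmetric])

lemma sum_pairs_csize:
  "(\<Sum>u<n. \<Sum>v<n. f (csize h M u) * g (csize h M v)) = csum n h M f * csum n h M g"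
  unfolding csum_def by (rule sum_product[symmetric])

lemma sum_offdiag_le:
  fixes D :: "nat \<Rightarrow> nat \<Rightarrow> real"
  assumes "\<And>u v. 0 \<le> D u v"
  shows "(\<Sum>u<n. \<Sum>v\<in>{..<n} - {u}. D u v) \<le> (\<Sum>u<n. \<Sum>v<n. D u v)"
  by (intro sum_mono sum_mono2) (use assms in auto)

lemma sum_offdiag_const:
  "(\<Sum>u<n. \<Sum>v\<in>{..<n} - {u}. c) = real n * (real n - 1) * (c::real)"
  by (cases n) (simp_all add: card_Diff_singleton)

lemma small_exp_nonneg: "0 \<le> \<beta> \<Longrightarrow> 0 \<le> small_exp l \<beta> a"
  by (simp add: small_exp_def)

lemma large_exp_nonneg: "0 \<le> large_exp l \<mu> a"
  by (simp add: large_exp_def)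

text \<open>The tangent of \<open>exp\<close> at \<open>y\<close> lies below its graph. Lowering the
  exponent thus loses at least the step times the derivative at the lower exponent.\<close>

lemma exp_shift_ge:
  fixes x y :: real
  shows "exp y + (x - y) * exp y \<le> exp x"
proof -
  have "exp y * (1 + (x - y)) \<le> exp y * exp (x - y)"
    by (intro mult_left_mono exp_ge_add_one_self) auto
  then show ?thesis by (simp add: algebra_simps flip: exp_add)
qed

text \<open>Halving the exponent at least halves exp x - 1. This is the origin of the pairs \<beta>
  / 2 and y / 2 below.\<close>

lemma two_exp_half_le: "2 * exp (x / 2) \<le> exp (x::real) + 1"
proof -
  have "0 \<le> (exp (x / 2) - 1)\<^sup>2" by simp
  also have "(exp (x / 2) - 1)\<^sup>2 = exp x - 2 * exp (x / 2) + 1"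
    by (simp add: power2_diff exp_double[symmetric])
  finally show ?thesis by simp
qed

text \<open>Equivalent to x \<le> sinh x. It bounds a moment with an extra factor of the size, at
  half the exponent, by the plain moment at the full exponent.\<close>

lemma mult_exp_le: "0 \<le> (x::real) \<Longrightarrow> 2 * x * exp x \<le> exp (2 * x) - 1"
proof -
  assume x: "0 \<le> x"
  have "((\<lambda>x. exp (2*x) - 1 - 2 * x * exp x) has_real_derivative
      2 * exp (2*x) - (2 * exp x + 2 * x * exp x)) (at x)" for x :: real
    by (auto intro!: derivative_eq_intros)
  moreover have "0 \<le> 2 * exp (2*x) - (2 * exp x + 2 * x * exp x)" for x :: real
    using exp_shift_ge[of x "2*x"] by (simp add: algebra_simps)
  ultimately have "exp (2*0) - 1 - 2 * 0 * exp 0 \<le> exp (2*x) - 1 - 2 * x * exp x"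
    by (intro DERIV_nonneg_imp_nondecreasing[OF x]) blast
  then show ?thesis by simp
qed

text \<open>In the limit of many vertices the mean \<open>\<phi>\<close> of \<open>exp (\<beta> c) - 1\<close> over the component sizes \<open>c\<close>
  satisfies Burgers' equation \<open>\<partial>\<phi>/\<partial>t = 2 \<phi> \<partial>\<phi>/\<partial>\<beta>\<close>. Lowering \<open>\<beta>\<close> at rate \<open>2 y\<close> therefore makes
  the mean a supermartingale while it stays below \<open>y\<close>. Cutting off at size \<open>l\<close> keeps the
  increments \<open>\<delta>\<close> small enough for a second moment bound.\<close>

lemma small_step:
  assumes valid: "valid_history n h" and n: "n \<ge> 2" and l: "0 \<le> l"
    and lam: "0 \<le> \<beta>'" "\<beta> = \<beta>' + 2 * y / (real n - 1)" and y: "0 \<le> y"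
  obtains \<delta> where
    "\<And>u v k. u < n \<Longrightarrow> v < n \<Longrightarrow> u \<noteq> v \<Longrightarrow>
      csum n (h @ [({u, v}, k)]) M (small_exp l \<beta>') \<le> csum n h M (small_exp l \<beta>) + \<delta> u v"
    "\<And>u v. \<bar>\<delta> u v\<bar> \<le> (4 * y + 1) * l * exp (\<beta> * l)"
    "csum n h M (small_exp l \<beta>) \<le> real n * y \<Longrightarrow> (\<Sum>u<n. \<Sum>v\<in>{..<n} - {u}. \<delta> u v) \<le> 0"
proof -
  let ?c = "csize h M"
  \<comment> \<open>\<open>p1\<close> is the derivative of \<open>p\<close> in the exponent.
    \<open>W\<close> below is the exact gain of a merge that stays within the cutoff; a merge that
    crosses the cutoff only lowers the sum.\<close>
  define p p1 where "p = small_exp l \<beta>'"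
    and "p1 a = (if real a \<le> l then real a * exp (\<beta>' * real a) else 0)" for a
  define P0 P P1 where "P0 = csum n h M (small_exp l \<beta>)" "P = csum n h M p" "P1 = csum n h M p1"
  define W where "W a b = (if real (a + b) \<le> l then p1 a * p b + p1 b * p a else 0)" for a b
  define \<delta> where "\<delta> u v = (P - P0) + W (?c u) (?c v)" for u v
  define s where "s = 2 * y / (real n - 1)"
  have n1: "real n - 1 \<ge> 1" using n by auto
  have s: "0 \<le> s" "real n * s \<le> 4 * y" "\<beta> = \<beta>' + s" "s * (real n - 1) = 2 * y"
  proof -
    have "real n * s = 2 * y * (real n / (real n - 1))" by (simp add: s_def)
    also have "\<dots> \<le> 2 * y * 2"
      by (intro mult_left_mono) (use n1 n y in \<open>auto simp: divide_le_eq\<close>)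
    finally show "real n * s \<le> 4 * y" by simp
  qed (use y n1 lam in \<open>auto simp: s_def\<close>)
  have p0: "0 \<le> p a" "0 \<le> p1 a" for a
    using lam by (auto simp: p_def p1_def small_exp_nonneg)
  have W0: "0 \<le> W a b" for a b using p0 by (simp add: W_def)
  have Wle: "W a b \<le> p1 a * p b + p1 b * p a" for a b using p0 by (simp add: W_def)
  have small_diff: "p a + s * p1 a \<le> small_exp l \<beta> a" "small_exp l \<beta> a \<le> p a + s * (l * exp (\<beta> * l))" for a
  proof -
    show "p a + s * p1 a \<le> small_exp l \<beta> a"
      using exp_shift_ge[of "\<beta>' * real a" "\<beta> * real a"] s
      by (auto simp: p_def p1_def small_exp_def algebra_simps)
    show "small_exp l \<beta> a \<le> p a + s * (l * exp (\<beta> * l))"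
    proof (cases "real a \<le> l")
      case True
      have "real a * exp (\<beta> * real a) \<le> l * exp (\<beta> * l)"
        using True lam s l by (intro mult_mono) (auto intro!: mult_left_mono)
      from mult_left_mono[OF this s(1)] show ?thesis
        using exp_shift_ge[of "\<beta> * real a" "\<beta>' * real a"] s True
        by (auto simp: p_def small_exp_def algebra_simps)
    qed (use s l in \<open>simp add: p_def small_exp_def\<close>)
  qed
  \<comment> \<open>The lower bound on the loss \<open>P0 - P\<close> gives the drift, the upper
    bound limits the size of the increments.\<close>
  have PP: "P + s * P1 \<le> P0" "P0 \<le> P + real n * (s * (l * exp (\<beta> * l)))"
  proof -
    show "P + s * P1 \<le> P0"
      unfolding P0_P_P1_def csum_cmult[symmetric] csum_add[symmetric]
      by (rule csum_mono) (rule small_diff)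
    have "P0 \<le> csum n h M (\<lambda>a. p a + s * (l * exp (\<beta> * l)))"
      unfolding P0_P_P1_def by (rule csum_mono) (rule small_diff)
    then show "P0 \<le> P + real n * (s * (l * exp (\<beta> * l)))"
      unfolding csum_add P0_P_P1_def by (simp add: csum_def)
  qed
  have P0s: "0 \<le> P" "0 \<le> P1" unfolding P0_P_P1_def by (auto intro!: csum_nonneg p0)
  show thesis
  proof
    fix u v k assume uv: "u < n" "v < n" "u \<noteq> v"
    have "csum n (h @ [({u, v}, k)]) M p \<le> csum n h M p + W (?c u) (?c v)"
      unfolding csum_def
    proof (rule sum_csize_append_le[OF valid uv(1,2) W0])
      fix a b assume ab: "a = ?c u" "b = ?c v"
      show "real (a + b) * p (a + b) - real a * p a - real b * p b \<le> W (?c u) (?c v)"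
      proof (cases "real (a + b) \<le> l")
        case True
        then show ?thesis unfolding W_def ab[symmetric] p_def small_exp_def p1_def
          by (simp add: algebra_simps exp_add)
      next
        case False
        then have "p (a + b) = 0" by (simp add: p_def small_exp_def)
        moreover have "0 \<le> real a * p a" "0 \<le> real b * p b" using p0 by auto
        ultimately show ?thesis using W0[of a b] ab by simp
      qed
    qed
    then show "csum n (h @ [({u, v}, k)]) M (small_exp l \<beta>') \<le> csum n h M (small_exp l \<beta>) + \<delta> u v"
      by (simp add: \<delta>_def P0_P_P1_def p_def)
  next
    fix u v
    have "W a b \<le> l * exp (\<beta> * l)" for a b
    proof (cases "real (a + b) \<le> l")
      case True
      then have ab: "real a \<le> l" "real b \<le> l" by auto
      have "W a b \<le> p1 a * exp (\<beta>' * b) + p1 b * exp (\<beta>' * a)"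
        using Wle[of a b] ab mult_left_mono[OF _ p0(2), of "p b" "exp (\<beta>' * b)" a]
          mult_left_mono[OF _ p0(2), of "p a" "exp (\<beta>' * a)" b]
        by (simp add: p_def small_exp_def)
      also have "\<dots> = real (a + b) * exp (\<beta>' * real (a + b))"
        using ab by (simp add: p1_def algebra_simps exp_add)
      also have "\<dots> \<le> l * exp (\<beta> * l)"
        using True lam s l by (intro mult_mono) (auto intro!: mult_mono)
      finally show ?thesis .
    qed (use l in \<open>simp add: W_def\<close>)
    then have W: "W (?c u) (?c v) \<le> l * exp (\<beta> * l)" .
    have *: "real n * (s * (l * exp (\<beta> * l))) \<le> 4 * y * (l * exp (\<beta> * l))"
      using mult_right_mono[OF s(2), of "l * exp (\<beta> * l)"] l by (simp add: mult.assoc)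
    have "0 \<le> l * exp (\<beta> * l)" "0 \<le> s * P1" using l s P0s by auto
    moreover have "(4 * y + 1) * l * exp (\<beta> * l) = 4 * y * (l * exp (\<beta> * l)) + l * exp (\<beta> * l)"
      by (simp add: algebra_simps)
    moreover have "0 \<le> 4 * y * (l * exp (\<beta> * l))" using y l by auto
    ultimately show "\<bar>\<delta> u v\<bar> \<le> (4 * y + 1) * l * exp (\<beta> * l)"
      using W W0[of "?c u" "?c v"] PP * unfolding \<delta>_def by linarith
  next
    assume "csum n h M (small_exp l \<beta>) \<le> real n * y"
    then have Py: "P \<le> real n * y" using PP s P0s mult_nonneg_nonneg[of s P1] unfolding P0_P_P1_def by linarith
    have "(\<Sum>u<n. \<Sum>v\<in>{..<n} - {u}. W (?c u) (?c v)) \<le> (\<Sum>u<n. \<Sum>v<n. W (?c u) (?c v))"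
      by (rule sum_offdiag_le) (rule W0)
    also have "\<dots> \<le> (\<Sum>u<n. \<Sum>v<n. p1 (?c u) * p (?c v) + p (?c u) * p1 (?c v))"
      using Wle by (intro sum_mono) (simp add: mult.commute)
    also have "\<dots> = 2 * P1 * P"
      by (simp add: sum.distrib sum_pairs_csize P0_P_P1_def)
    finally have "(\<Sum>u<n. \<Sum>v\<in>{..<n} - {u}. \<delta> u v) \<le> real n * (real n - 1) * (P - P0) + 2 * P1 * P"
      unfolding \<delta>_def sum.distrib sum_offdiag_const by simp
    \<comment> \<open>The merge gain \<open>2 * P1 * P\<close> is at most
      \<open>2 * P1 * n * y\<close>, and the step \<open>s = 2 * y / (n - 1)\<close> is chosen so
      that the loss over all ordered pairs cancels exactly this.\<close>
    also have "\<dots> \<le> real n * (real n - 1) * (- (s * P1)) + 2 * P1 * (real n * y)"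
      using PP Py P0s n1 by (intro add_mono mult_left_mono) auto
    also have "\<dots> = real n * P1 * (2 * y - s * (real n - 1))" by (simp add: algebra_simps)
    also have "\<dots> = 0" using s by simp
    finally show "(\<Sum>u<n. \<Sum>v\<in>{..<n} - {u}. \<delta> u v) \<le> 0" .
  qed
qed

text \<open>Components larger than \<open>l\<close> make increments too big for a second moment bound, but they carry so
  little weight that Markov's inequality is enough. They are weighted with \<open>\<beta> / 2\<close>, so that the control
  of small components at \<open>\<beta>\<close> bounds the rate at which large ones are created.\<close>

lemma large_step:
  assumes valid: "valid_history n h" and n: "n \<ge> 2" and l: "0 \<le> l"
    and lam: "0 < \<beta>m" "\<beta>m \<le> \<beta>'" "\<beta> = \<beta>' + 2 * y / (real n - 1)" and y: "0 \<le> y"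
    and x: "csum n h M (small_exp l \<beta>) \<le> real n * (y - \<eta>)"
    and X2: "csum n h M (large_exp l (\<beta> / 2)) \<le> real n * (\<eta> / 2)" and \<eta>: "0 \<le> \<eta>"
  obtains D where
    "\<And>u v k. u < n \<Longrightarrow> v < n \<Longrightarrow> u \<noteq> v \<Longrightarrow>
      csum n (h @ [({u, v}, k)]) M (large_exp l (\<beta>' / 2)) \<le> D u v"
    "(\<Sum>u<n. \<Sum>v\<in>{..<n} - {u}. D u v) \<le> real n * (real n - 1) *
       (csum n h M (large_exp l (\<beta> / 2)) * (1 + (2 * y / \<beta>m) / (real n - 1)) +
        real n * (2 * l * exp (- \<beta>m * l / 2) * (y + 1)\<^sup>2) / (real n - 1))"
proof -
  let ?c = "csize h M"
  define g g1 p p1 q where "g = large_exp l (\<beta>' / 2)"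
    and "g1 a = real a * g a" and "p = small_exp l (\<beta>' / 2)"
    and "p1 a = (if real a \<le> l then real a * exp (\<beta>' / 2 * real a) else 0)"
    and "q a = (if real a \<le> l then exp (\<beta>' * real a) else 0)" for a
  define c0 where "c0 = 2 * l * exp (- \<beta>m * l / 2)"
  define s where "s = 2 * y / (real n - 1)"
  \<comment> \<open>The first four products pay for merges involving a component above the cutoff;
    the \<open>c0\<close> term pays for two small components whose union exceeds it.\<close>
  define W where "W a b = g1 a * (g b + p b) + (g a + p a) * g1 b + g a * p1 b + p1 a * g b + c0 * q a * q b" for a b
  define G G0 G1 P P1 Q X0 where defs:
    "G = csum n h M g" "G0 = csum n h M (large_exp l (\<beta> / 2))" "G1 = csum n h M g1"
    "P = csum n h M p" "P1 = csum n h M p1" "Q = csum n h M q" "X0 = csum n h M (small_exp l \<beta>)"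
  have n1: "real n - 1 \<ge> 1" using n by auto
  have lam': "0 < \<beta>'" using lam by auto
  have s: "0 \<le> s" "\<beta> = \<beta>' + s" "s * (real n - 1) = 2 * y"
    using y n1 lam by (auto simp: s_def)
  have c0: "0 \<le> c0" using l by (simp add: c0_def)
  have nn: "0 \<le> g a" "0 \<le> g1 a" "0 \<le> p a" "0 \<le> p1 a" "0 \<le> q a" for a
    using lam' by (auto simp: g_def g1_def p_def p1_def q_def large_exp_def small_exp_def)
  have W0: "0 \<le> W a b" for a b using nn c0 by (simp add: W_def)
  have NN: "0 \<le> G" "0 \<le> G1" "0 \<le> P" "0 \<le> P1" "0 \<le> Q" "0 \<le> G0"
    unfolding defs by (auto intro!: csum_nonneg nn large_exp_nonneg)
  have Wstep: "real (a + b) * g (a + b) - real a * g a - real b * g b \<le> W a b" for a b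
  proof (cases "real (a + b) \<le> l")
    case True
    then show ?thesis using W0[of a b] by (simp add: g_def large_exp_def)
  next
    case ab: False
    let ?e = "\<lambda>x::nat. exp (\<beta>' / 2 * real x)"
    have new: "real (a + b) * g (a + b) = real a * (?e a * ?e b) + real b * (?e a * ?e b)"
      using ab by (simp add: g_def large_exp_def exp_add[symmetric] algebra_simps add_divide_distrib)
    consider "real a \<le> l" "real b \<le> l" | "real a \<le> l" "real b > l" | "real a > l" "real b \<le> l"
      | "real a > l" "real b > l" by linarith
    then show ?thesis
    proof cases
      case 1
      \<comment> \<open>The union has size between \<open>l\<close> and \<open>2 * l\<close>, so its
        weight at exponent \<open>\<beta>' / 2\<close> is smaller than at \<open>\<beta>'\<close> by
        at least the factor exp (- \<beta>m l / 2).\<close>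
      have "real (a + b) * g (a + b) = real (a + b) * exp (\<beta>' / 2 * real (a + b))"
        using ab by (simp add: g_def large_exp_def)
      also have "\<dots> \<le> 2 * l * (exp (- \<beta>m * l / 2) * exp (\<beta>' * real (a + b)))"
      proof (intro mult_mono)
        have "\<beta>m * l \<le> \<beta>' * real (a + b)" using lam ab l by (intro mult_mono) auto
        then have "\<beta>' / 2 * real (a + b) \<le> - \<beta>m * l / 2 + \<beta>' * real (a + b)"
          by (simp add: field_simps)
        then show "exp (\<beta>' / 2 * real (a + b)) \<le> exp (- \<beta>m * l / 2) * exp (\<beta>' * real (a + b))"
          by (simp only: exp_add[symmetric] exp_le_cancel_iff)
      qed (use 1 l in auto)
      also have "\<dots> = c0 * q a * q b"
        using 1 by (simp add: c0_def q_def exp_add algebra_simps)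
      also have "\<dots> \<le> W a b" using nn by (simp add: W_def)
      finally show ?thesis
        using mult_nonneg_nonneg[OF _ nn(1), of "real a" a] mult_nonneg_nonneg[OF _ nn(1), of "real b" b]
        by linarith
    next
      case 2
      then have "W a b = p a * g1 b + p1 a * g b"
        by (simp add: W_def g_def large_exp_def g1_def p_def p1_def q_def small_exp_def)
      then show ?thesis unfolding new using 2
        by (simp add: g_def large_exp_def g1_def p_def p1_def small_exp_def algebra_simps)
    next
      case 3
      then have "W a b = g1 a * p b + g a * p1 b"
        by (simp add: W_def g_def large_exp_def g1_def p_def p1_def q_def small_exp_def)
      then show ?thesis unfolding new using 3
        by (simp add: g_def large_exp_def g1_def p_def p1_def small_exp_def algebra_simps)
    next
      case 4
      then have "W a b = g1 a * g b + g a * g1 b"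
        by (simp add: W_def p_def p1_def q_def small_exp_def)
      then show ?thesis unfolding new using 4
        by (simp add: g_def large_exp_def g1_def algebra_simps)
    qed
  qed
  have GG: "G + s / 2 * G1 \<le> G0"
    unfolding defs csum_cmult[symmetric] csum_add[symmetric]
  proof (rule csum_mono)
    fix a show "g a + s / 2 * g1 a \<le> large_exp l (\<beta> / 2) a"
      using exp_shift_ge[of "\<beta>' / 2 * real a" "\<beta> / 2 * real a"] s
      by (auto simp: g_def g1_def large_exp_def field_simps)
  qed
  \<comment> \<open>The exponent \<open>\<beta> / 2\<close> falls only half as fast as \<beta>, so
    it can absorb a total moment of \<open>n * y / 2\<close> only; the halved exponent supplies the
    factor 2.\<close>
  have Ple: "2 * P \<le> X0"
    unfolding defs csum_cmult[symmetric]
  proof (rule csum_mono)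
    fix a
    have 1: "2 * exp (\<beta>' / 2 * real a) \<le> exp (\<beta>' * real a) + 1"
      using two_exp_half_le[of "\<beta>' * real a"] by simp
    have "\<beta>' * real a \<le> \<beta> * real a" using s by (simp add: mult_right_mono)
    then have "exp (\<beta>' * real a) \<le> exp (\<beta> * real a)" by (simp only: exp_le_cancel_iff)
    with 1 have "2 * exp (\<beta>' / 2 * real a) \<le> exp (\<beta> * real a) + 1" by linarith
    then show "2 * p a \<le> small_exp l \<beta> a"
      by (simp add: p_def small_exp_def)
  qed
  have P1le: "\<beta>m * P1 \<le> X0"
    unfolding defs csum_cmult[symmetric]
  proof (rule csum_mono)
    fix a
    have "\<beta>m * (real a * exp (\<beta>' / 2 * real a)) \<le> 2 * (\<beta>' / 2 * real a) * exp (\<beta>' / 2 * real a)"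
      using mult_right_mono[OF lam(2), of "real a * exp (\<beta>' / 2 * real a)"] by (simp add: mult.assoc)
    also have "\<dots> \<le> exp (2 * (\<beta>' / 2 * real a)) - 1"
      by (rule mult_exp_le) (use lam in auto)
    also have "\<dots> \<le> exp (\<beta> * real a) - 1" using s by (simp add: mult_right_mono)
    finally show "\<beta>m * p1 a \<le> small_exp l \<beta> a"
      by (simp add: p1_def small_exp_def)
  qed
  have Qle: "Q \<le> X0 + real n"
  proof -
    have "q a \<le> small_exp l \<beta> a + 1" for a
      using s by (simp add: q_def small_exp_def mult_right_mono)
    then have "Q \<le> csum n h M (\<lambda>a. small_exp l \<beta> a + 1)" unfolding defs by (rule csum_mono)
    then show ?thesis unfolding csum_add defs by (simp add: csum_def)
  qed
  have X0: "X0 \<le> real n * (y - \<eta>)" "X0 \<le> real n * y"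
    using x mult_nonneg_nonneg[OF of_nat_0_le_iff \<eta>, of n] unfolding defs right_diff_distrib
    by linarith+
  have G0: "G0 \<le> real n * (\<eta> / 2)" using X2 by (simp add: defs)
  have Gle: "G \<le> G0" using GG s NN mult_nonneg_nonneg[of "s/2" G1] by linarith
  show thesis
  proof
    fix u v k assume uv: "u < n" "v < n" "u \<noteq> v"
    show "csum n (h @ [({u, v}, k)]) M (large_exp l (\<beta>' / 2)) \<le> G + W (?c u) (?c v)"
      unfolding defs csum_def g_def[symmetric]
      by (rule sum_csize_append_le[OF valid uv(1,2) W0]) (use Wstep in auto)
  next
    have "(\<Sum>u<n. \<Sum>v\<in>{..<n} - {u}. W (?c u) (?c v)) \<le> (\<Sum>u<n. \<Sum>v<n. W (?c u) (?c v))"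
      by (rule sum_offdiag_le) (rule W0)
    also have "\<dots> = 2 * G1 * (G + P) + 2 * G * P1 + c0 * Q\<^sup>2"
    proof -
      have "csum n h M (\<lambda>a. g a + p a) = G + P" by (simp add: csum_add defs)
      moreover have "(\<Sum>u<n. \<Sum>v<n. c0 * q (?c u) * q (?c v)) = c0 * (Q * Q)"
        unfolding defs sum_pairs_csize[symmetric] by (simp add: sum_distrib_left mult.assoc)
      ultimately show ?thesis
        unfolding W_def sum.distrib
          sum_pairs_csize[of g1 h M "\<lambda>a. g a + p a" n] sum_pairs_csize[of "\<lambda>a. g a + p a" h M g1 n]
          sum_pairs_csize
        by (simp add: defs power2_eq_square algebra_simps)
    qed
    finally have "(\<Sum>u<n. \<Sum>v\<in>{..<n} - {u}. G + W (?c u) (?c v)) \<le>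
        real n * (real n - 1) * G + (2 * G1 * (G + P) + 2 * G * P1 + c0 * Q\<^sup>2)"
      unfolding sum.distrib sum_offdiag_const by simp
    also have "\<dots> \<le> real n * (real n - 1) * (G0 - s / 2 * G1) +
        (2 * G1 * (real n * y / 2) + 2 * G0 * (real n * y / \<beta>m) + c0 * (real n * (y + 1))\<^sup>2)"
    proof (intro add_mono mult_left_mono mult_mono power_mono)
      show "G \<le> G0 - s / 2 * G1" using GG by simp
      \<comment> \<open>The margin \<eta> pays for the large components: \<open>P\<close> is at most
        \<open>n * (y - \<eta>) / 2\<close> and \<open>G\<close> at most
        \<open>n * \<eta> / 2\<close>.\<close>
      show "G + P \<le> real n * y / 2" using Gle G0 Ple X0 by (simp add: algebra_simps)
      show "P1 \<le> real n * y / \<beta>m"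
        using P1le X0 lam by (simp add: pos_le_divide_eq mult.commute)
      show "Q \<le> real n * (y + 1)" using Qle X0 by (simp add: algebra_simps)
    qed (use NN n1 Gle c0 in auto)
    also have "\<dots> = real n * (real n - 1) * G0 + 2 * G0 * (real n * y / \<beta>m) + c0 * (real n * (y + 1))\<^sup>2
        + real n * G1 * (y - s * (real n - 1) / 2)"
      by (simp add: field_simps)
    also have "\<dots> = real n * (real n - 1) *
       (G0 * (1 + (2 * y / \<beta>m) / (real n - 1)) + real n * (c0 * (y + 1)\<^sup>2) / (real n - 1))"
    proof -
      have "N * d * (G0 * (1 + r / d) + N * t / d) = N * d * G0 + N * G0 * r + N * N * t"
        if "d \<noteq> 0" for N d r t :: real
        using that by (simp add: field_simps)
      from this[of "real n - 1" "real n" "2 * y / \<beta>m" "c0 * (y + 1)\<^sup>2"] show ?thesis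
        using n1 s(3) by (simp add: power2_eq_square algebra_simps)
    qed
    finally show "(\<Sum>u<n. \<Sum>v\<in>{..<n} - {u}. G + W (?c u) (?c v)) \<le> real n * (real n - 1) *
       (csum n h M (large_exp l (\<beta> / 2)) * (1 + (2 * y / \<beta>m) / (real n - 1)) +
        real n * (2 * l * exp (- \<beta>m * l / 2) * (y + 1)\<^sup>2) / (real n - 1))"
      unfolding c0_def defs .
  qed
qed
text \<open>The potential \<open>V\<close> is almost a supermartingale while it is below \<open>1\<close>, so \<open>min 1 V\<close> is almost a
  supermartingale unconditionally and no stopping time is needed.\<close>

lemma phase_bound:
  fixes \<beta>0 \<beta>m y y0 \<eta> l :: real and A :: algorithm and m1 m2 n :: nat
  assumes n: "n \<ge> 2" and m: "m1 \<le> m2" and pos: "0 < \<eta>" "0 \<le> y0" "0 < \<beta>m" "0 \<le> l"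
    and y: "y = y0 + 2 * \<eta>"
    and beta: "\<beta>m + 2 * y * real (m2 - m1) / (real n - 1) \<le> \<beta>0"
    and start: "\<And>h. S h \<Longrightarrow> csum n h M (expm \<beta>0) \<le> real n * y0"
  defines "\<rho> \<equiv> 1 + (2 * y / \<beta>m) / (real n - 1)"
  defines "c \<equiv> ((4 * y + 1) * l * exp (\<beta>0 * l) / (real n * \<eta>))\<^sup>2 +
      2 / \<eta> * \<rho> ^ (m2 - m1) * (2 * l * exp (- \<beta>m * l / 2) * (y + 1)\<^sup>2) / (real n - 1)"
  shows "measure_pmf.prob (coloured_process n A m2)
      {h. S (take m1 h) \<and> \<not> csum n h M (expm (\<beta>m / 2)) \<le> real n * (y / 2)} \<le>
    2 / \<eta> * \<rho> ^ (m2 - m1) * (exp (- \<beta>0 * l / 2) * (1 + y0)) + real (m2 - m1) * c"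
proof -
  define T where "T = m2 - m1"
  define b where "b i = \<beta>0 - 2 * y * real i / (real n - 1)" for i :: nat
  define x where "x i h = csum n h M (small_exp l (b i)) / real n" for i h
  define x2 where "x2 i h = csum n h M (large_exp l (b i / 2)) / real n" for i h
  define z where "z i h = max 0 (x i h - y0)" for i h
  \<comment> \<open>Squaring the upward deviation makes its fluctuation cost of order 1 / n^2 per
    round, up to the cutoff factors in \<kappa>. The power of \<rho> shrinks each round just enough
    to offset the growth factor \<rho> of the large part. \<open>V < 1\<close> forces both
    hypotheses of the one-round estimates.\<close>
  define V where "V i h = (z i h / \<eta>)\<^sup>2 + 2 / \<eta> * \<rho> ^ (T - i) * x2 i h" for i h
  \<comment> \<open>Setting the value to 0 when the phase starts badly replaces conditioning on
    \<open>S\<close>.\<close>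
  define X where "X j h = (if S (take m1 h) then min 1 (V (j - m1) h) else 0)" for j h
  define \<kappa> where "\<kappa> = (4 * y + 1) * l * exp (\<beta>0 * l)"
  define src where "src = 2 * l * exp (- \<beta>m * l / 2) * (y + 1)\<^sup>2"
  have n1: "real n - 1 \<ge> 1" "real n > 0" using n by auto
  have y0: "0 < y" using pos y by auto
  have rho: "1 \<le> \<rho>" using n1 y0 pos unfolding \<rho>_def by auto
  have rhop: "1 \<le> \<rho> ^ k" "0 \<le> \<rho> ^ k" for k using rho by auto
  have src0: "0 \<le> src" using pos unfolding src_def by auto
  have c0: "0 \<le> c" unfolding c_def src_def[symmetric] using rhop(2)[of "m2 - m1"] src0 n1 pos by auto
  have c: "c = (\<kappa> / (real n * \<eta>))\<^sup>2 + 2 / \<eta> * \<rho> ^ T * src / (real n - 1)"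
    unfolding c_def \<kappa>_def src_def T_def ..
  have x2_0: "0 \<le> x2 i h" for i h
    unfolding x2_def using n1 by (auto intro!: divide_nonneg_nonneg csum_nonneg large_exp_nonneg)
  have V0: "0 \<le> V i h" for i h
    unfolding V_def using x2_0[of i h] rhop(2)[of "T - i"] pos by simp
  have X01: "0 \<le> X j h" "X j h \<le> 1" for j h
    using V0[of "j - m1" h] by (auto simp: X_def)
  have b_ge: "\<beta>m \<le> b i" if "i \<le> T" for i
  proof -
    have "2 * y * real i / (real n - 1) \<le> 2 * y * real T / (real n - 1)"
      using that y0 n1 by (intro divide_right_mono mult_left_mono) auto
    then show ?thesis using beta unfolding b_def T_def by linarith
  qed
  have b_Suc: "b i = b (Suc i) + 2 * y / (real n - 1)" for i
    unfolding b_def by (simp add: field_simps add_divide_distrib)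
  have good: "x i h \<le> y - \<eta>" "x2 i h \<le> \<eta> / 2" if "V i h < 1" for i h
  proof -
    have nn: "0 \<le> (z i h / \<eta>)\<^sup>2" "0 \<le> 2 / \<eta> * \<rho> ^ (T - i) * x2 i h"
      using x2_0[of i h] rhop(2)[of "T - i"] pos by simp_all
    have "(z i h / \<eta>)\<^sup>2 < 1\<^sup>2" using that nn unfolding V_def by simp
    then have "z i h / \<eta> < 1" by (rule power_less_imp_less_base) simp
    then have "z i h < \<eta>" using pos by simp
    then show "x i h \<le> y - \<eta>" using y unfolding z_def by simp
    have "2 / \<eta> * x2 i h \<le> 2 / \<eta> * \<rho> ^ (T - i) * x2 i h"
      using x2_0[of i h] rhop(1)[of "T - i"] pos by (intro mult_right_mono) (simp_all add: divide_right_mono)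
    then have "2 / \<eta> * x2 i h \<le> 1" using that nn unfolding V_def by linarith
    then show "x2 i h \<le> \<eta> / 2" using pos by (simp add: field_simps)
  qed
  have step: "measure_pmf.expectation (coloured_process n A (Suc j)) (X (Suc j)) \<le>
      measure_pmf.expectation (coloured_process n A j) (X j) + c"
    if j: "m1 \<le> j" "j < m2" for j
  proof -
    define i where "i = j - m1"
    have i: "i < T" "Suc j - m1 = Suc i" using j by (auto simp: i_def T_def)
    have "\<exists>F. (\<forall>u<n. \<forall>v<n. \<forall>k. u \<noteq> v \<longrightarrow> X (Suc j) (h @ [({u, v}, k)]) \<le> F u v) \<and>
        (\<Sum>u<n. \<Sum>v\<in>{..<n} - {u}. F u v) \<le> real n * (real n - 1) * (X j h + c)"
      if h: "h \<in> set_pmf (coloured_process n A j)" for h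
    proof -
      have val: "length h = j" "valid_history n h" using set_pmf_process[OF n h] by auto
      have tk: "take m1 (h @ [e]) = take m1 h" for e using val j by simp
      consider "\<not> S (take m1 h)" | "S (take m1 h)" "V i h \<ge> 1" | "S (take m1 h)" "V i h < 1"
        by linarith
      then show ?thesis
      proof cases
        case 1
        then show ?thesis using tk n1 c0
          by (intro exI[of _ "\<lambda>_ _. 0"]) (auto simp: X_def)
      next
        case 2
        then have "X j h = 1" by (simp add: X_def i_def)
        then show ?thesis using X01 n1 c0 unfolding sum_offdiag_const
          by (intro exI[of _ "\<lambda>_ _. 1"]) (auto simp: sum_offdiag_const)
      next
        case 3
        note g = good[OF 3(2)]
        have csx: "csum n h M (small_exp l (b i)) = real n * x i h"
          "csum n h M (large_exp l (b i / 2)) = real n * x2 i h"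
          using n1 by (auto simp: x_def x2_def)
        have bS: "\<beta>m \<le> b (Suc i)" by (rule b_ge) (use i in auto)
        have bn: "0 \<le> b (Suc i)" "0 \<le> y" "real n * x i h \<le> real n * (y - \<eta>)"
          "real n * x2 i h \<le> real n * (\<eta> / 2)" "0 \<le> \<eta>"
          using bS pos y0 g n1 by (auto intro!: mult_left_mono)
        have bi: "b i \<le> \<beta>0" unfolding b_def using y0 n1 by simp
        obtain \<delta> where d:
          "\<And>u v k. u < n \<Longrightarrow> v < n \<Longrightarrow> u \<noteq> v \<Longrightarrow>
            csum n (h @ [({u, v}, k)]) M (small_exp l (b (Suc i))) \<le> real n * x i h + \<delta> u v"
          "\<And>u v. \<bar>\<delta> u v\<bar> \<le> (4 * y + 1) * l * exp (b i * l)"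
          "real n * x i h \<le> real n * y \<Longrightarrow> (\<Sum>u<n. \<Sum>v\<in>{..<n} - {u}. \<delta> u v) \<le> 0"
          by (rule small_step[OF val(2) n pos(4) bn(1) b_Suc[of i] bn(2), where M = M, unfolded csx])
             (rule that, assumption+)
        have d3: "(\<Sum>u<n. \<Sum>v\<in>{..<n} - {u}. \<delta> u v) \<le> 0"
          by (rule d(3)) (use g pos n1 in \<open>auto intro!: mult_left_mono\<close>)
        have d2: "(\<delta> u v / (real n * \<eta>))\<^sup>2 \<le> (\<kappa> / (real n * \<eta>))\<^sup>2" for u v
        proof -
          have "(4 * y + 1) * l * exp (b i * l) \<le> \<kappa>"
            unfolding \<kappa>_def using bi pos y0 by (intro mult_left_mono) (auto intro: mult_right_mono)
          then have "\<bar>\<delta> u v\<bar> \<le> \<kappa>" using d(2)[of u v] by linarith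
          then have "\<bar>\<delta> u v / (real n * \<eta>)\<bar> \<le> \<kappa> / (real n * \<eta>)"
            using n1 pos by (simp add: abs_mult divide_right_mono)
          from power_mono[OF this, of 2] show ?thesis by (simp only: power2_abs abs_ge_zero)
        qed
        obtain D where D:
          "\<And>u v k. u < n \<Longrightarrow> v < n \<Longrightarrow> u \<noteq> v \<Longrightarrow>
            csum n (h @ [({u, v}, k)]) M (large_exp l (b (Suc i) / 2)) \<le> D u v"
          "(\<Sum>u<n. \<Sum>v\<in>{..<n} - {u}. D u v) \<le> real n * (real n - 1) *
             (real n * x2 i h * \<rho> + real n * src / (real n - 1))"
          by (rule large_step[OF val(2) n pos(4) pos(3) bS b_Suc[of i] bn(2), where M = M and \<eta> = \<eta>,
                unfolded csx, folded \<rho>_def src_def, OF bn(3-5)])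
             (rule that, assumption+)
        define r where "r = 2 / \<eta> * \<rho> ^ (T - Suc i)"
        have r0: "0 \<le> r" unfolding r_def using rhop(2)[of "T - Suc i"] pos by simp
        define F where "F u v = (z i h / \<eta>)\<^sup>2 + (\<kappa> / (real n * \<eta>))\<^sup>2 +
          2 * z i h / (real n * \<eta>\<^sup>2) * \<delta> u v + r / real n * D u v" for u v
        have z0: "0 \<le> z i h" by (simp add: z_def)
        have F: "X (Suc j) (h @ [({u, v}, k)]) \<le> F u v" if uv: "u < n" "v < n" "u \<noteq> v" for u v k
        proof -
          let ?h = "h @ [({u, v}, k)]"
          have x': "x (Suc i) ?h \<le> x i h + \<delta> u v / real n"
            using d(1)[OF uv, of k] n1 by (simp add: x_def[of "Suc i"] field_simps)
          \<comment> \<open>Bounding the positive part by an absolute value before squaring leaves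
            \<delta> in a linear term, whose sum over pairs is nonpositive, and in a square bounded
            through \<kappa>.\<close>
          have "z (Suc i) ?h \<le> \<bar>z i h + \<delta> u v / real n\<bar>"
            using x' unfolding z_def by (simp add: max_def abs_if split: if_splits)
          then have "z (Suc i) ?h / \<eta> \<le> \<bar>(z i h + \<delta> u v / real n) / \<eta>\<bar>"
            using pos by (simp add: divide_right_mono)
          then have "(z (Suc i) ?h / \<eta>)\<^sup>2 \<le> ((z i h + \<delta> u v / real n) / \<eta>)\<^sup>2"
            by (subst power2_abs[symmetric, of "(z i h + _) / _"], intro power_mono)
               (use pos in \<open>simp_all add: z_def\<close>)
          also have "\<dots> = (z i h / \<eta>)\<^sup>2 + (\<delta> u v / (real n * \<eta>))\<^sup>2 + 2 * z i h / (real n * \<eta>\<^sup>2) * \<delta> u v"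
            using pos n1 by (simp add: field_simps power2_eq_square)
          finally have 1: "(z (Suc i) ?h / \<eta>)\<^sup>2 \<le> (z i h / \<eta>)\<^sup>2 + (\<kappa> / (real n * \<eta>))\<^sup>2 + 2 * z i h / (real n * \<eta>\<^sup>2) * \<delta> u v"
            using d2[of u v] by linarith
          have "x2 (Suc i) ?h \<le> D u v / real n"
            using D(1)[OF uv, of k] n1 by (simp add: x2_def divide_right_mono)
          from mult_left_mono[OF this r0]
          have 2: "r * x2 (Suc i) ?h \<le> r / real n * D u v" by simp
          have "X (Suc j) ?h \<le> V (Suc i) ?h"
            using 3 tk i V0[of "Suc i" ?h] by (simp add: X_def)
          also have "\<dots> \<le> F u v" using 1 2 unfolding V_def F_def r_def by linarith
          finally show ?thesis .
        qed
        have "(\<Sum>u<n. \<Sum>v\<in>{..<n} - {u}. F u v) = real n * (real n - 1) * ((z i h / \<eta>)\<^sup>2 + (\<kappa> / (real n * \<eta>))\<^sup>2) +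
            2 * z i h / (real n * \<eta>\<^sup>2) * (\<Sum>u<n. \<Sum>v\<in>{..<n} - {u}. \<delta> u v) +
            r / real n * (\<Sum>u<n. \<Sum>v\<in>{..<n} - {u}. D u v)"
          unfolding F_def sum.distrib sum_offdiag_const
          unfolding sum_distrib_left[symmetric] by (simp add: distrib_left)
        also have "\<dots> \<le> real n * (real n - 1) * ((z i h / \<eta>)\<^sup>2 + (\<kappa> / (real n * \<eta>))\<^sup>2) + 0 +
            r / real n * (real n * (real n - 1) *
             (real n * x2 i h * \<rho> + real n * src / (real n - 1)))"
          using d3 D(2) r0 z0 n1 pos
          by (intro add_mono mult_left_mono order_refl mult_nonneg_nonpos divide_nonneg_pos) auto
        also have "\<dots> = real n * (real n - 1) * ((z i h / \<eta>)\<^sup>2 + (\<kappa> / (real n * \<eta>))\<^sup>2 +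
             r * \<rho> * x2 i h + r * src / (real n - 1))"
          using n1 by (simp add: field_simps)
        also have "\<dots> \<le> real n * (real n - 1) * (X j h + c)"
        proof (rule mult_left_mono)
          have rr: "r * \<rho> = 2 / \<eta> * \<rho> ^ (T - i)"
            unfolding r_def using i by (simp add: Suc_diff_Suc flip: power_Suc2)
          have "r * src / (real n - 1) \<le> 2 / \<eta> * \<rho> ^ T * src / (real n - 1)"
            unfolding r_def using rho src0 n1 pos
            by (intro divide_right_mono mult_right_mono mult_left_mono power_increasing) auto
          moreover have "X j h = (z i h / \<eta>)\<^sup>2 + r * \<rho> * x2 i h"
            using 3 unfolding rr by (simp add: X_def V_def flip: i_def)
          ultimately show "(z i h / \<eta>)\<^sup>2 + (\<kappa> / (real n * \<eta>))\<^sup>2 + r * \<rho> * x2 i h + r * src / (real n - 1) \<le> X j h + c"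
            unfolding c by linarith
        qed (use n1 in auto)
        finally show ?thesis using F by (intro exI[of _ F]) auto
      qed
    qed
    then have "\<forall>h\<in>set_pmf (coloured_process n A j). \<exists>F.
        (\<forall>u<n. \<forall>v<n. \<forall>k. u \<noteq> v \<longrightarrow> X (Suc j) (h @ [({u, v}, k)]) \<le> F u v) \<and>
        (\<Sum>u<n. \<Sum>v\<in>{..<n} - {u}. F u v) \<le> real n * (real n - 1) * (X j h + c)"
      by (rule ballI)
    from bchoice[OF this] obtain F where F: "\<forall>h\<in>set_pmf (coloured_process n A j).
        (\<forall>u<n. \<forall>v<n. \<forall>k. u \<noteq> v \<longrightarrow> X (Suc j) (h @ [({u, v}, k)]) \<le> F h u v) \<and>
        (\<Sum>u<n. \<Sum>v\<in>{..<n} - {u}. F h u v) \<le> real n * (real n - 1) * (X j h + c)"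
      by (elim exE)
    show ?thesis
      by (rule expectation_step[OF n X01 X01, where F = F]) (use F in \<open>simp_all\<close>)
  qed
  have init: "measure_pmf.expectation (coloured_process n A m1) (X m1) \<le>
      2 / \<eta> * \<rho> ^ T * (exp (- \<beta>0 * l / 2) * (1 + y0))"
  proof (rule measure_pmf.integral_le_const)
    have "X m1 h \<le> 2 / \<eta> * \<rho> ^ T * (exp (- \<beta>0 * l / 2) * (1 + y0))"
      if h: "h \<in> set_pmf (coloured_process n A m1)" for h
    proof (cases "S (take m1 h)")
      case True
      then have "S h" using set_pmf_process[OF n h] by simp
      note st = start[OF this]
      have b0: "b 0 = \<beta>0" by (simp add: b_def)
      have beta0: "0 \<le> \<beta>0" using b_ge[of 0] pos b0 by simp
      have "csum n h M (small_exp l \<beta>0) \<le> csum n h M (expm \<beta>0)"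
        using beta0 by (intro csum_mono) (simp add: small_exp_def expm_def)
      then have "x 0 h \<le> y0" using st n1 unfolding x_def b0 by (simp add: field_simps)
      then have z: "z 0 h = 0" by (simp add: z_def)
      \<comment> \<open>Above the cutoff, passing from exponent \<open>\<beta>0\<close> to half of
        it gains a factor exp (- \<beta>0 l / 2).\<close>
      have "csum n h M (large_exp l (\<beta>0 / 2)) \<le> csum n h M (\<lambda>a. exp (- \<beta>0 * l / 2) * (expm \<beta>0 a + 1))"
      proof (rule csum_mono)
        fix a
        have "exp (\<beta>0 / 2 * real a) \<le> exp (- \<beta>0 * l / 2) * exp (\<beta>0 * real a)" if "real a > l"
        proof -
          have "\<beta>0 * l \<le> \<beta>0 * real a" using that beta0 by (intro mult_left_mono) auto
          then have "\<beta>0 / 2 * real a \<le> - \<beta>0 * l / 2 + \<beta>0 * real a" by (simp add: field_simps)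
          then show ?thesis by (simp only: exp_add[symmetric] exp_le_cancel_iff)
        qed
        then show "large_exp l (\<beta>0 / 2) a \<le> exp (- \<beta>0 * l / 2) * (expm \<beta>0 a + 1)"
          by (simp add: large_exp_def expm_def)
      qed
      also have "\<dots> = exp (- \<beta>0 * l / 2) * (csum n h M (expm \<beta>0) + real n)"
        unfolding csum_cmult csum_add by (simp add: csum_def)
      also have "\<dots> \<le> exp (- \<beta>0 * l / 2) * (real n * y0 + real n)"
        using st by (intro mult_left_mono) auto
      finally have "x2 0 h \<le> exp (- \<beta>0 * l / 2) * (1 + y0)"
        unfolding x2_def b0 using n1 by (simp add: field_simps)
      then have "2 / \<eta> * \<rho> ^ T * x2 0 h \<le> 2 / \<eta> * \<rho> ^ T * (exp (- \<beta>0 * l / 2) * (1 + y0))"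
        using rhop(2)[of T] pos by (intro mult_left_mono) auto
      then show ?thesis using True z by (simp add: X_def V_def)
    next
      case False
      then show ?thesis using pos rhop(2)[of T] by (simp add: X_def)
    qed
    then show "AE h in coloured_process n A m1. X m1 h \<le> 2 / \<eta> * \<rho> ^ T * (exp (- \<beta>0 * l / 2) * (1 + y0))"
      by (simp add: AE_measure_pmf_iff)
  qed (rule integrable_unit_interval[OF X01])
  have "measure_pmf.prob (coloured_process n A m2)
      {h. S (take m1 h) \<and> \<not> csum n h M (expm (\<beta>m / 2)) \<le> real n * (y / 2)} \<le>
      measure_pmf.expectation (coloured_process n A m2) (X m2)"
  proof (rule prob_le_expectation[OF X01])
    fix h assume h: "h \<in> {h. S (take m1 h) \<and> \<not> csum n h M (expm (\<beta>m / 2)) \<le> real n * (y / 2)}"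
    have "\<not> V T h < 1"
    proof
      assume V: "V T h < 1"
      \<comment> \<open>The small part contributes at most half of y - \<eta> per vertex and the
        large part at most \<eta> / 2, in total y / 2.\<close>
      have "csum n h M (expm (\<beta>m / 2)) \<le> csum n h M (\<lambda>a. 1/2 * small_exp l (b T) a + large_exp l (b T / 2) a)"
      proof (rule csum_mono)
        fix a
        have bT: "\<beta>m \<le> b T" by (rule b_ge) simp
        have "\<beta>m / 2 * real a \<le> b T / 2 * real a" using bT by (intro mult_right_mono) auto
        then have 1: "exp (\<beta>m / 2 * real a) \<le> exp (b T / 2 * real a)" by simp
        have "2 * exp (b T / 2 * real a) \<le> exp (b T * real a) + 1"
          using two_exp_half_le[of "b T * real a"] by simp
        then have "exp (\<beta>m / 2 * real a) - 1 \<le> (exp (b T * real a) - 1) / 2"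
          "exp (\<beta>m / 2 * real a) - 1 \<le> exp (b T / 2 * real a)"
          using 1 by argo+
        then show "expm (\<beta>m / 2) a \<le> 1/2 * small_exp l (b T) a + large_exp l (b T / 2) a"
          unfolding expm_def small_exp_def large_exp_def by simp
      qed
      also have "\<dots> = real n * (x T h / 2 + x2 T h)"
        unfolding csum_add csum_cmult x_def x2_def using n1 by (simp add: field_simps)
      also have "\<dots> \<le> real n * (y / 2)"
        using good[OF V] by (intro mult_left_mono) auto
      finally show False using h by simp
    qed
    then show "X m2 h = 1" using h by (simp add: X_def T_def)
  qed
  also have "\<dots> \<le> measure_pmf.expectation (coloured_process n A m1) (X m1) + real (m2 - m1) * c"
    by (rule expectation_steps[OF m step])
  finally show ?thesis using init unfolding T_def by linarith
qed
section \<open>Splitting a colour group\<close>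

text \<open>Twice the number of connected pairs is the sum of \<open>c - 1\<close> over the component sizes \<open>c\<close>.
  A round whose edge joins two different components of the group \<open>M\<close> adds at least as many
  connected pairs to \<open>M\<close> as to the part of \<open>M\<close> it belongs to, so the excess grows only in the rare
  rounds in which the edge closes a cycle of \<open>M\<close>.\<close>

definition excess :: "nat \<Rightarrow> history \<Rightarrow> nat set \<Rightarrow> nat set \<Rightarrow> real" where
  "excess n h M1 M2 = csum n h M1 real + csum n h M2 real - real n - csum n h (M1 \<union> M2) real"

text \<open>The merge increment for the identity is (a + b)^2 - a^2 - b^2 = 2ab.\<close>

lemma csum_real_append:
  assumes valid: "valid_history n h" and uv: "u < n" "v < n"
  shows "csum n (h @ [({u, v}, k)]) M real = csum n h M real +
    (if k \<in> M \<and> \<not> linked h M u v then 2 * real (csize h M u) * real (csize h M v) else 0)"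
  using sum_csize_merge[OF valid uv, of k M real] csize_append_linked[OF valid, of k M u v]
  by (auto simp: csum_def algebra_simps)

lemma excess_step:
  assumes valid: "valid_history n h" and uv: "u < n" "v < n" and disj: "M1 \<inter> M2 = {}"
    and B: "linked h (M1 \<union> M2) u v \<Longrightarrow> real (csize h (M1 \<union> M2) u) \<le> B"
  shows "excess n (h @ [({u, v}, k)]) M1 M2 \<le> excess n h M1 M2 +
    (if linked h (M1 \<union> M2) u v then 2 * B\<^sup>2 else 0)"
proof -
  let ?M = "M1 \<union> M2"
  have le: "real (csize h M u) * real (csize h M v) \<le> real (csize h ?M u) * real (csize h ?M v)"
    if "M \<subseteq> ?M" for M
    using csize_mono[OF valid uv(1) that] csize_mono[OF valid uv(2) that] by (intro mult_mono) auto
  have sq: "real (csize h ?M u) * real (csize h ?M v) \<le> B\<^sup>2" if l: "linked h ?M u v"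
    using B[OF l] csize_linked[OF valid l] by (simp add: power2_eq_square mult_mono)
  show ?thesis
  proof (cases "linked h ?M u v")
    case True
    then show ?thesis
      using disj le[of M1] le[of M2] sq zero_le_power2[of B]
      by (auto simp: excess_def csum_real_append[OF valid uv])
  next
    case False
    then have "\<not> linked h M1 u v" "\<not> linked h M2 u v"
      using linked_mono[OF valid] by blast+
    then show ?thesis
      using disj le[of M1] le[of M2] False
      by (auto simp: excess_def csum_real_append[OF valid uv])
  qed
qed

text \<open>With all components of size at most \<open>B\<close>, a random edge closes a cycle with
  probability at most B / (n - 1) and then costs at most 2 B^2. Markov's inequality at level n
  \<epsilon> gives the bound.\<close>

lemma excess_bound:
  fixes B \<epsilon> :: real and A :: algorithm
  assumes n: "n \<ge> 2" and B: "0 \<le> B" and \<epsilon>: "0 < \<epsilon>" and disj: "M1 \<inter> M2 = {}"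
  shows "measure_pmf.prob (coloured_process n A T)
      {h. (\<forall>v<n. real (csize h (M1 \<union> M2) v) \<le> B) \<and> excess n h M1 M2 \<ge> real n * \<epsilon>} \<le>
    real T * (2 * B ^ 3 / (\<epsilon> * real n * (real n - 1)))"
proof -
  let ?M = "M1 \<union> M2"
  define ok where "ok h = (\<forall>v<n. real (csize h ?M v) \<le> B)" for h
  \<comment> \<open>Components only grow, so \<open>ok\<close> once lost stays lost, and putting the
    value 0 there never produces a later increase.\<close>
  define g where "g h = (if ok h then max 0 (excess n h M1 M2 / (real n * \<epsilon>)) else 0)" for h
  define X where "X h = min 1 (g h)" for h
  define c where "c = 2 * B ^ 3 / (\<epsilon> * real n * (real n - 1))"
  have n1: "real n - 1 \<ge> 1" "real n > 0" using n by auto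
  have X01: "0 \<le> X h" "X h \<le> 1" for h by (auto simp: X_def g_def)
  have c0: "0 \<le> c" using B \<epsilon> n1 unfolding c_def by auto
  have step: "measure_pmf.expectation (coloured_process n A (Suc m)) X \<le>
      measure_pmf.expectation (coloured_process n A m) X + c" for m
  proof -
    define W where "W h u v = (if linked h ?M u v \<and> real (csize h ?M u) \<le> B
      then 2 * B\<^sup>2 / (real n * \<epsilon>) else 0)" for h u v
    have W0: "0 \<le> W h u v" for h u v using n1 \<epsilon> by (simp add: W_def)
    show ?thesis
    proof (rule expectation_step[OF n X01 X01, where F = "\<lambda>h u v. X h + W h u v"])
      fix h u v k
      assume h: "h \<in> set_pmf (coloured_process n A m)" and uv: "u < n" "v < n" "u \<noteq> v"
      have val: "valid_history n h" using set_pmf_process[OF n h] by auto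
      let ?h = "h @ [({u, v}, k)]"
      show "X ?h \<le> X h + W h u v"
      proof (cases "ok ?h")
        case True
        have ok: "ok h"
          unfolding ok_def
        proof (intro allI impI)
          fix w assume w: "w < n"
          have "real (csize h ?M w) \<le> real (csize ?h ?M w)"
            using csize_le_append[OF val uv w] by simp
          then show "real (csize h ?M w) \<le> B" using True w unfolding ok_def by fastforce
        qed
        have "excess n ?h M1 M2 \<le> excess n h M1 M2 + (if linked h ?M u v then 2 * B\<^sup>2 else 0)"
          using ok uv by (intro excess_step[OF val uv(1,2) disj]) (auto simp: ok_def)
        then have "excess n ?h M1 M2 / (real n * \<epsilon>) \<le>
            (excess n h M1 M2 + (if linked h ?M u v then 2 * B\<^sup>2 else 0)) / (real n * \<epsilon>)"
          using n1 \<epsilon> by (intro divide_right_mono) auto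
        also have "\<dots> = excess n h M1 M2 / (real n * \<epsilon>) + W h u v"
          using ok uv by (auto simp: W_def ok_def add_divide_distrib)
        finally show ?thesis using True ok W0[of h u v] by (auto simp: X_def g_def)
      next
        case False
        then show ?thesis using X01[of h] W0[of h u v] by (simp add: X_def[of ?h] g_def)
      qed
    next
      fix h assume h: "h \<in> set_pmf (coloured_process n A m)"
      have val: "valid_history n h" using set_pmf_process[OF n h] by auto
      have row: "(\<Sum>v<n. W h u v) \<le> 2 * B ^ 3 / (real n * \<epsilon>)" if u: "u < n" for u
      proof (cases "real (csize h ?M u) \<le> B")
        case True
        let ?C = "component (group_adj h ?M) u"
        have sub: "?C \<subseteq> {..<n}" by (rule component_below[OF val u])
        have "(\<Sum>v<n. W h u v) = (\<Sum>v\<in>?C. 2 * B\<^sup>2 / (real n * \<epsilon>))"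
          by (rule sum.mono_neutral_cong_right) (use sub True in \<open>auto simp: W_def linked_def\<close>)
        also have "\<dots> = real (csize h ?M u) * (2 * B\<^sup>2 / (real n * \<epsilon>))"
          by (simp add: csize_def)
        also have "\<dots> \<le> B * (2 * B\<^sup>2 / (real n * \<epsilon>))"
          using True n1 \<epsilon> by (intro mult_right_mono) auto
        finally show ?thesis by (simp add: power2_eq_square power3_eq_cube mult_ac)
      next
        case False
        then show ?thesis using B n1 \<epsilon> by (simp add: W_def)
      qed
      have "(\<Sum>u<n. \<Sum>v\<in>{..<n} - {u}. X h + W h u v) \<le>
          real n * (real n - 1) * X h + (\<Sum>u<n. \<Sum>v<n. W h u v)"
        unfolding sum.distrib sum_offdiag_const
        using sum_offdiag_le[of "W h" n] W0 by simp
      also have "(\<Sum>u<n. \<Sum>v<n. W h u v) \<le> (\<Sum>u<n. 2 * B ^ 3 / (real n * \<epsilon>))"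
        by (intro sum_mono row) auto
      also have "\<dots> = real n * (real n - 1) * c"
        using n1 \<epsilon> by (simp add: c_def field_simps)
      finally show "(\<Sum>u<n. \<Sum>v\<in>{..<n} - {u}. X h + W h u v) \<le> real n * (real n - 1) * (X h + c)"
        by (simp add: distrib_left)
    qed
  qed
  have "measure_pmf.prob (coloured_process n A T) {h. ok h \<and> excess n h M1 M2 \<ge> real n * \<epsilon>} \<le>
      measure_pmf.expectation (coloured_process n A T) X"
  proof (rule prob_le_expectation[OF X01])
    fix h assume "h \<in> {h. ok h \<and> excess n h M1 M2 \<ge> real n * \<epsilon>}"
    then have "ok h" "1 \<le> excess n h M1 M2 / (real n * \<epsilon>)" using n1 \<epsilon> by (simp_all add: pos_le_divide_eq)
    then show "X h = 1" by (simp add: X_def g_def)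
  qed
  also have "\<dots> \<le> measure_pmf.expectation (coloured_process n A 0) X + real (T - 0) * c"
    by (rule expectation_steps[where X = "\<lambda>_. X"]) (use step in auto)
  also have "measure_pmf.expectation (coloured_process n A 0) X = 0"
  proof -
    have "csize [] M w = 1" for M w
      by (simp add: csize_def component_def group_adj_def)
    then show ?thesis by (simp add: X_def g_def excess_def csum_def)
  qed
  finally show ?thesis by (simp add: c_def ok_def)
qed
section \<open>Phases in the limit of many vertices\<close>

text \<open>The moment bound keeps components logarithmic and lets the next phase start, for any
  \<beta> and \<open>Y\<close>; the mean \<open>s\<close> is the quantity propagated
  sharply.\<close>

definition good :: "nat \<Rightarrow> nat set \<Rightarrow> real \<Rightarrow> real \<Rightarrow> real \<Rightarrow> history \<Rightarrow> bool" where
  "good n M \<beta> Y s h \<longleftrightarrow>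
     csum n h M (expm \<beta>) \<le> real n * Y \<and> csum n h M real \<le> real n * s"

text \<open>A second-order Taylor bound, with the quadratic remainder absorbed by the exponential at
  the larger exponent. For small \<open>\<beta>0\<close> the moment is therefore governed by the
  mean size.\<close>

lemma expm_le_quadratic:
  assumes "0 \<le> \<beta>0" "\<beta>0 \<le> \<beta> / 2" "0 < \<beta>"
  shows "expm \<beta>0 a \<le> \<beta>0 * real a + 8 * (\<beta>0 / \<beta>)\<^sup>2 * (expm \<beta> a + 1)"
proof -
  define x w where "x = \<beta>0 * real a" and "w = \<beta> / 2 * real a"
  have x: "0 \<le> x" "x \<le> w" using assms(1) mult_right_mono[OF assms(2), of "real a"] by (auto simp: x_def w_def)
  have xw: "x = 2 * (\<beta>0 / \<beta>) * w" using assms by (simp add: x_def w_def)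
  have 1: "exp x - 1 \<le> x * exp x" using exp_shift_ge[of x 0] by simp
  have "exp x - 1 - x \<le> x * (exp x - 1)" using 1 by (simp add: algebra_simps)
  also have "\<dots> \<le> x * (x * exp x)" using 1 x by (intro mult_left_mono) auto
  also have "\<dots> = x\<^sup>2 * exp x" by (simp add: power2_eq_square)
  also have "\<dots> \<le> x\<^sup>2 * exp w" using x by (intro mult_left_mono) auto
  also have "\<dots> = 4 * (\<beta>0 / \<beta>)\<^sup>2 * (w\<^sup>2 * exp w)" unfolding xw by (simp add: power2_eq_square)
  also have "\<dots> \<le> 4 * (\<beta>0 / \<beta>)\<^sup>2 * (2 * exp w * exp w)"
    using exp_lower_Taylor_quadratic[of w] x by (intro mult_left_mono mult_right_mono) auto
  also have "2 * exp w * exp w = 2 * (expm \<beta> a + 1)"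
    by (simp add: w_def expm_def flip: exp_add)
  finally show ?thesis by (simp add: expm_def x_def)
qed

lemma tendsto_zero_probI:
  assumes "eventually (\<lambda>n. measure_pmf.prob (p n) (S n) \<le> f n) sequentially" "f \<longlonglongrightarrow> 0"
  shows "(\<lambda>n. measure_pmf.prob (p n) (S n)) \<longlonglongrightarrow> 0"
  by (rule tendsto_sandwich[OF _ assms(1) tendsto_const assms(2)]) simp

lemma ex_pos_pairI:
  fixes a b :: real
  shows "0 < a \<Longrightarrow> 0 < b \<Longrightarrow> P a b \<Longrightarrow> \<exists>x>0. \<exists>y>0. P x y"
  by blast

text \<open>Start at a small exponent \<open>\<beta>0\<close>, where the moment is below
  \<open>y = \<beta>0 * \<sigma>\<close>. Lowering the exponent at rate 2 y per n rounds leaves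
  \<open>\<beta>m = \<beta>0 * (1 - 2 * t * \<sigma>)\<close>, and the ratio
  \<open>y / \<beta>m\<close> is the new mean. The new constants are fixed before \<open>A\<close>
  and \<open>M\<close>, as the uniform constant in O(log n) requires.\<close>

lemma phase_whp:
  fixes \<beta> Y s \<sigma> t :: real and m1 m2 :: "nat \<Rightarrow> nat"
  assumes pos: "0 < \<beta>" "0 \<le> Y" "0 \<le> s" "s < \<sigma>" "0 < t" "2 * t * \<sigma> < 1"
    and m: "\<And>n. m1 n \<le> m2 n"
    and mt: "eventually (\<lambda>n. real (m2 n - m1 n) \<le> t * (real n - 1)) sequentially"
  shows "\<exists>\<beta>'>0. \<exists>Y'>0. \<forall>A :: nat \<Rightarrow> algorithm. \<forall>M.
    (\<lambda>n. measure_pmf.prob (coloured_process n (A n) (m2 n))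
      {h. good n M \<beta> Y s (take (m1 n) h) \<and> \<not> good n M \<beta>' Y' (\<sigma> / (1 - 2 * t * \<sigma>)) h}) \<longlonglongrightarrow> 0"
proof -
  \<comment> \<open>The second entry of the minimum keeps the quadratic remainder below half of the
    gap, \<open>\<beta>0 * (\<sigma> - s) / 2\<close>. The other half of the gap is
    \<open>2 * \<eta>\<close>.\<close>
  define \<beta>0 where "\<beta>0 = min (\<beta> / 2) ((\<sigma> - s) * \<beta>\<^sup>2 / (16 * (Y + 1)))"
  define y y0 \<eta> \<beta>m where "y = \<beta>0 * \<sigma>" and "y0 = \<beta>0 * ((s + \<sigma>) / 2)" and "\<eta> = \<beta>0 * (\<sigma> - s) / 4"
    and "\<beta>m = \<beta>0 * (1 - 2 * t * \<sigma>)"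
  define C K where "C = 2 * y / \<beta>m" and "K = 2 / \<eta> * exp (C * t)"
  have b0: "\<beta>0 \<le> \<beta> / 2" "0 < \<beta>0"
    unfolding \<beta>0_def by (rule min.cobounded1) (use pos in simp)
  have \<sigma>: "0 < \<sigma>" using pos by auto
  have P: "0 < y" "0 < y0" "0 < \<eta>" "0 < \<beta>m" "0 < C" "0 < K"
    using b0 pos \<sigma> by (auto simp: y_def y0_def \<eta>_def \<beta>m_def C_def K_def)
  have small: "8 * \<beta>0\<^sup>2 / \<beta>\<^sup>2 * (Y + 1) \<le> \<beta>0 * ((\<sigma> - s) / 2)"
  proof -
    have "\<beta>0 \<le> (\<sigma> - s) * \<beta>\<^sup>2 / (16 * (Y + 1))" unfolding \<beta>0_def by simp
    then have "16 * (Y + 1) * \<beta>0 \<le> (\<sigma> - s) * \<beta>\<^sup>2" using pos by (simp add: field_simps)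
    then have "8 * (Y + 1) * \<beta>0 / \<beta>\<^sup>2 \<le> (\<sigma> - s) / 2" using pos by (simp add: field_simps)
    from mult_left_mono[OF this, of \<beta>0] show ?thesis using b0
      by (simp add: power2_eq_square field_simps)
  qed
  have start: "csum n h M (expm \<beta>0) \<le> real n * y0" if "good n M \<beta> Y s h" for n M h
  proof -
    let ?q = "8 * (\<beta>0 / \<beta>)\<^sup>2"
    have "csum n h M (expm \<beta>0) \<le> csum n h M (\<lambda>a. \<beta>0 * real a + ?q * (expm \<beta> a + 1))"
      by (rule csum_mono) (rule expm_le_quadratic, use b0 pos in auto)
    also have "\<dots> = \<beta>0 * csum n h M real + ?q * (csum n h M (expm \<beta>) + real n)"
      unfolding csum_add csum_cmult by (simp add: csum_def)
    also have "\<dots> \<le> \<beta>0 * (real n * s) + ?q * (real n * Y + real n)"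
      using that b0 by (intro add_mono mult_left_mono) (auto simp: good_def)
    also have "\<dots> = real n * (\<beta>0 * s + 8 * \<beta>0\<^sup>2 / \<beta>\<^sup>2 * (Y + 1))"
      by (simp add: field_simps)
    also have "\<dots> \<le> real n * (\<beta>0 * s + \<beta>0 * ((\<sigma> - s) / 2))"
      using small by (intro mult_left_mono) auto
    also have "\<dots> = real n * y0" by (simp add: y0_def field_simps)
    finally show ?thesis .
  qed
  have out: "good n M (\<beta>m / 2) (y / 2) (\<sigma> / (1 - 2 * t * \<sigma>)) h"
    if h: "csum n h M (expm (\<beta>m / 2)) \<le> real n * (y / 2)" for n M h
  proof -
    have "\<beta>m / 2 * csum n h M real \<le> csum n h M (expm (\<beta>m / 2))"
      unfolding csum_cmult[symmetric]
    proof (rule csum_mono)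
      fix a show "\<beta>m / 2 * real a \<le> expm (\<beta>m / 2) a"
        using exp_ge_add_one_self[of "\<beta>m / 2 * real a"] unfolding expm_def by linarith
    qed
    then have "\<beta>m / 2 * csum n h M real \<le> real n * (y / 2)" using h by linarith
    then have "csum n h M real \<le> real n * (y / \<beta>m)" using P by (simp add: field_simps)
    moreover have "y / \<beta>m = \<sigma> / (1 - 2 * t * \<sigma>)" using b0 by (simp add: y_def \<beta>m_def)
    ultimately show ?thesis using h by (simp add: good_def)
  qed
  \<comment> \<open>This cutoff gives exp (\<beta>0 l) = n^(1/4): the squared increments over all
    rounds sum to order l^2 n^(-1/2), while the large components still cost only n^(-1/8) and l
    n^(-\<gamma>).\<close>
  define l where "l n = ln (real n) / (4 * \<beta>0)" for n
  define \<gamma> where "\<gamma> = \<beta>m / (8 * \<beta>0)"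
  define bnd where "bnd n = K * (1 + y0) * real n powr (- 1/8) +
      t * ((4 * y + 1) / \<eta>)\<^sup>2 * ((l n)\<^sup>2 * real n powr (- 1/2)) +
      t * K * (2 * (y + 1)\<^sup>2) * (l n * real n powr (- \<gamma>))" for n
  have "0 < \<gamma>" using P b0 by (simp add: \<gamma>_def)
  have "bnd \<longlonglongrightarrow> K * (1 + y0) * 0 + t * ((4 * y + 1) / \<eta>)\<^sup>2 * 0 + t * K * (2 * (y + 1)\<^sup>2) * 0"
    unfolding bnd_def
  proof (intro tendsto_add tendsto_mult_left)
    show "(\<lambda>n. real n powr (- 1/8)) \<longlonglongrightarrow> 0" by real_asymp
    show "(\<lambda>n. (l n)\<^sup>2 * real n powr (- 1/2)) \<longlonglongrightarrow> 0" unfolding l_def using b0 by real_asymp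
    show "(\<lambda>n. l n * real n powr (- \<gamma>)) \<longlonglongrightarrow> 0" unfolding l_def using b0 \<open>0 < \<gamma>\<close> by real_asymp
  qed
  then have bnd: "bnd \<longlonglongrightarrow> 0" by simp
  show ?thesis
  proof (rule ex_pos_pairI[of "\<beta>m / 2" "y / 2"], use P in simp, use P in simp, intro allI)
    fix A :: "nat \<Rightarrow> algorithm" and M
    have "eventually (\<lambda>n. measure_pmf.prob (coloured_process n (A n) (m2 n))
      {h. good n M \<beta> Y s (take (m1 n) h) \<and> \<not> good n M (\<beta>m / 2) (y / 2) (\<sigma> / (1 - 2 * t * \<sigma>)) h} \<le> bnd n) sequentially"
      using mt eventually_ge_at_top[of "2::nat"]
    proof eventually_elim
      case (elim n)
      define N T where "N = real n" and "T = real (m2 n - m1 n)"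
      have N: "N - 1 \<ge> 1" "N > 0" using elim by (auto simp: N_def)
      have l0: "0 \<le> l n" using b0 elim by (simp add: l_def)
      define \<rho> where "\<rho> = 1 + (2 * y / \<beta>m) / (real n - 1)"
      let ?\<rho> = "\<rho> ^ (m2 n - m1 n)"
      have T: "T \<le> t * (N - 1)" "0 \<le> T" "T \<le> t * N" using elim pos by (auto simp: T_def N_def algebra_simps)
      have "T * (C / (N - 1)) \<le> (t * (N - 1)) * (C / (N - 1))"
        using T P N by (intro mult_right_mono) auto
      then have TC: "T * (C / (N - 1)) \<le> C * t" using N by (simp add: mult.commute)
      have "\<rho> \<le> exp (C / (N - 1))" unfolding \<rho>_def C_def N_def by (rule exp_ge_add_one_self)
      then have "?\<rho> \<le> exp (C / (N - 1)) ^ (m2 n - m1 n)"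
        using P N by (intro power_mono) (auto simp: \<rho>_def N_def)
      also have "\<dots> = exp (T * (C / (N - 1)))" by (simp only: T_def exp_of_nat_mult)
      also have "\<dots> \<le> exp (C * t)" using TC by simp
      finally have rho: "2 / \<eta> * ?\<rho> \<le> K" unfolding K_def using P by (intro mult_left_mono) auto
      have e1: "exp (- \<beta>0 * l n / 2) = N powr (- 1/8)" "exp (\<beta>0 * l n) ^ 2 = N powr (1/2)"
          "exp (- \<beta>m * l n / 2) = N powr (- \<gamma>)"
        using b0 N by (simp_all add: l_def \<gamma>_def powr_def N_def flip: exp_double)
      have "measure_pmf.prob (coloured_process n (A n) (m2 n))
          {h. good n M \<beta> Y s (take (m1 n) h) \<and> \<not> good n M (\<beta>m / 2) (y / 2) (\<sigma> / (1 - 2 * t * \<sigma>)) h} \<le>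
        measure_pmf.prob (coloured_process n (A n) (m2 n))
          {h. good n M \<beta> Y s (take (m1 n) h) \<and> \<not> csum n h M (expm (\<beta>m / 2)) \<le> real n * (y / 2)}"
        by (intro measure_pmf.finite_measure_mono) (use out in auto)
      also have "\<dots> \<le> 2 / \<eta> * ?\<rho> * (exp (- \<beta>0 * l n / 2) * (1 + y0)) + T *
          (((4 * y + 1) * l n * exp (\<beta>0 * l n) / (N * \<eta>))\<^sup>2 +
           2 / \<eta> * ?\<rho> * (2 * l n * exp (- \<beta>m * l n / 2) * (y + 1)\<^sup>2) / (N - 1))"
        unfolding \<rho>_def T_def N_def
      proof (rule phase_bound)
        have "2 * y * real (m2 n - m1 n) / (real n - 1) \<le> 2 * y * t"
          using T P N by (simp add: T_def N_def divide_le_eq mult.assoc)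
        then show "\<beta>m + 2 * y * real (m2 n - m1 n) / (real n - 1) \<le> \<beta>0"
          unfolding \<beta>m_def y_def by (simp add: algebra_simps)
        show "y = y0 + 2 * \<eta>" unfolding y_def y0_def \<eta>_def by (simp add: field_simps)
      qed (use elim m P l0 start in auto)
      also have "\<dots> = 2 / \<eta> * ?\<rho> * (N powr (- 1/8) * (1 + y0)) + T * (((4 * y + 1) / \<eta>)\<^sup>2 * ((l n)\<^sup>2 * N powr (1/2) / N\<^sup>2)) +
           T * (2 / \<eta> * ?\<rho> * (2 * l n * N powr (- \<gamma>) * (y + 1)\<^sup>2) / (N - 1))"
      proof -
        have "(w * a * e / (N * \<eta>))\<^sup>2 = (w / \<eta>)\<^sup>2 * (a\<^sup>2 * e\<^sup>2 / N\<^sup>2)" for w a e :: real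
          by (simp add: power_divide power_mult_distrib mult_ac)
        from this[of "4 * y + 1" "l n" "exp (\<beta>0 * l n)"] show ?thesis
          unfolding e1(1) e1(3) e1(2)[symmetric] by (simp only: distrib_left add.assoc)
      qed
      also have "\<dots> \<le> K * (N powr (- 1/8) * (1 + y0)) + (t * N) * (((4 * y + 1) / \<eta>)\<^sup>2 * ((l n)\<^sup>2 * N powr (1/2) / N\<^sup>2)) +
           (t * (N - 1)) * (K * (2 * l n * N powr (- \<gamma>) * (y + 1)\<^sup>2) / (N - 1))"
        using T rho P l0 N
        by (intro add_mono mult_mono divide_right_mono mult_right_mono) (auto simp: \<rho>_def N_def)
      also have "\<dots> = bnd n"
      proof -
        have a: "(t * N) * (q * ((l n)\<^sup>2 * N powr (1/2) / N\<^sup>2)) = t * q * ((l n)\<^sup>2 * N powr (- 1/2))" for q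
        proof -
          have "N powr (1/2) = N * N powr (- 1/2)"
            using N powr_add[of N 1 "- 1/2"] by simp
          then show ?thesis using N by (simp add: field_simps power2_eq_square)
        qed
        have b: "(t * (N - 1)) * (q / (N - 1)) = t * q" for q using N by simp
        show ?thesis unfolding a b bnd_def N_def[symmetric] by (simp add: mult_ac)
      qed
      finally show ?case .
    qed
    then show "(\<lambda>n. measure_pmf.prob (coloured_process n (A n) (m2 n))
      {h. good n M \<beta> Y s (take (m1 n) h) \<and> \<not> good n M (\<beta>m / 2) (y / 2) (\<sigma> / (1 - 2 * t * \<sigma>)) h}) \<longlonglongrightarrow> 0"
      using bnd by (rule tendsto_zero_probI)
  qed
qed

text \<open>One summand of the exponential moment is at most the whole sum, which makes every
  component logarithmic.\<close>

lemma good_csize_le: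
  assumes "good n M \<beta> Y s h" "0 < \<beta>" "0 < Y" "v < n"
  shows "real (csize h M v) \<le> ln (1 + real n * Y) / \<beta>"
proof -
  have "expm \<beta> (csize h M v) \<le> csum n h M (expm \<beta>)"
    unfolding csum_def
    by (rule member_le_sum[where f = "\<lambda>w. expm \<beta> (csize h M w)"]) (use assms in \<open>auto simp: expm_def\<close>)
  then have "exp (\<beta> * real (csize h M v)) \<le> 1 + real n * Y"
    using assms unfolding expm_def good_def by linarith
  then have "\<beta> * real (csize h M v) \<le> ln (1 + real n * Y)"
    using assms by (subst ln_ge_iff) (auto intro: add_pos_nonneg)
  then show ?thesis using assms by (simp add: field_simps)
qed

text \<open>Both halves inherit the exponential moment, so each can fail only through its mean. Both
  means above \<open>s'\<close> would force an excess of at least n (2 s' - 1 - s), which is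
  unlikely because components are logarithmic.\<close>

lemma split_whp:
  fixes \<beta> Y s s' \<tau> :: real and T :: "nat \<Rightarrow> nat"
  assumes pos: "0 < \<beta>" "0 < Y" and s': "(1 + s) / 2 < s'" and disj: "M1 \<inter> M2 = {}"
    and T: "eventually (\<lambda>n. real (T n) \<le> \<tau> * real n) sequentially"
  shows "(\<lambda>n. measure_pmf.prob (coloured_process n (A n) (T n))
      {h. good n (M1 \<union> M2) \<beta> Y s h \<and> \<not> good n M1 \<beta> Y s' h \<and> \<not> good n M2 \<beta> Y s' h}) \<longlonglongrightarrow> 0"
proof -
  let ?M = "M1 \<union> M2"
  define \<epsilon> where "\<epsilon> = 2 * s' - 1 - s"
  have \<epsilon>: "0 < \<epsilon>" using s' by (simp add: \<epsilon>_def)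
  define B where "B n = ln (1 + real n * Y) / \<beta>" for n
  define f where "f n = \<tau> * (2 / \<epsilon>) * ((B n) ^ 3 / (real n - 1))" for n
  have "f \<longlonglongrightarrow> \<tau> * (2 / \<epsilon>) * 0"
    unfolding f_def B_def using pos by (intro tendsto_mult_left) real_asymp
  then have f0: "f \<longlonglongrightarrow> 0" by simp
  have "eventually (\<lambda>n. measure_pmf.prob (coloured_process n (A n) (T n))
      {h. good n ?M \<beta> Y s h \<and> \<not> good n M1 \<beta> Y s' h \<and> \<not> good n M2 \<beta> Y s' h} \<le> f n) sequentially"
    using T eventually_ge_at_top[of "2::nat"]
  proof eventually_elim
    case (elim n)
    have n1: "real n - 1 > 0" "real n > 0" using elim by auto
    have B0: "0 \<le> B n" using pos by (simp add: B_def)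
    let ?P = "coloured_process n (A n) (T n)"
    have "measure_pmf.prob ?P
        {h. good n ?M \<beta> Y s h \<and> \<not> good n M1 \<beta> Y s' h \<and> \<not> good n M2 \<beta> Y s' h} \<le>
      measure_pmf.prob ?P
        {h. (\<forall>v<n. real (csize h ?M v) \<le> B n) \<and> excess n h M1 M2 \<ge> real n * \<epsilon>}"
    proof (rule measure_pmf.finite_measure_mono_AE)
      have "(\<forall>v<n. real (csize h ?M v) \<le> B n) \<and> excess n h M1 M2 \<ge> real n * \<epsilon>"
        if h: "h \<in> set_pmf ?P"
          and g: "good n ?M \<beta> Y s h" "\<not> good n M1 \<beta> Y s' h" "\<not> good n M2 \<beta> Y s' h" for h
      proof -
        have val: "valid_history n h" using set_pmf_process[OF _ h] elim by auto
        have big: "real n * s' < csum n h M real" if "M \<subseteq> ?M" "\<not> good n M \<beta> Y s' h" for M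
        proof -
          have "csum n h M (expm \<beta>) \<le> csum n h ?M (expm \<beta>)"
            unfolding csum_def
          proof (rule sum_mono)
            fix w assume "w \<in> {..<n}"
            then have "csize h M w \<le> csize h ?M w" using csize_mono[OF val _ that(1)] by simp
            then show "expm \<beta> (csize h M w) \<le> expm \<beta> (csize h ?M w)"
              using pos by (simp add: expm_def)
          qed
          then show ?thesis using g(1) that(2) by (auto simp: good_def)
        qed
        have "real n * \<epsilon> = real n * s' + real n * s' - real n - real n * s"
          by (simp add: \<epsilon>_def algebra_simps)
        also have "\<dots> \<le> excess n h M1 M2"
        proof -
          have "csum n h ?M real \<le> real n * s" using g(1) by (simp add: good_def)
          then show ?thesis using big[OF Un_upper1 g(2)] big[OF Un_upper2 g(3)]
            unfolding excess_def by linarith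
        qed
        finally show ?thesis using good_csize_le[OF g(1) pos] by (simp add: B_def)
      qed
      then show "AE h in ?P. h \<in> {h. good n ?M \<beta> Y s h \<and> \<not> good n M1 \<beta> Y s' h \<and> \<not> good n M2 \<beta> Y s' h} \<longrightarrow>
          h \<in> {h. (\<forall>v<n. real (csize h ?M v) \<le> B n) \<and> excess n h M1 M2 \<ge> real n * \<epsilon>}"
        by (auto simp: AE_measure_pmf_iff)
    qed simp
    also have "\<dots> \<le> real (T n) * (2 * B n ^ 3 / (\<epsilon> * real n * (real n - 1)))"
      by (rule excess_bound) (use elim B0 \<epsilon> disj in auto)
    also have "\<dots> \<le> \<tau> * real n * (2 * B n ^ 3 / (\<epsilon> * real n * (real n - 1)))"
      using elim n1 B0 \<epsilon> by (intro mult_right_mono) auto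
    also have "\<dots> = f n" using n1 \<epsilon> by (simp add: f_def field_simps)
    finally show ?case .
  qed
  then show ?thesis using f0 by (rule tendsto_zero_probI)
qed
section \<open>Iterating the phases\<close>

text \<open>These are the nodes at depth \<open>j\<close> of the binary tree that reads the binary
  digits of a colour from the lowest one.\<close>

definition residue :: "nat \<Rightarrow> nat \<Rightarrow> nat set" where
  "residue j a = {k. k mod 2 ^ j = a}"

lemma residue_split:
  assumes "a < 2 ^ j"
  shows "residue j a = residue (Suc j) a \<union> residue (Suc j) (a + 2 ^ j)"
    and "residue (Suc j) a \<inter> residue (Suc j) (a + 2 ^ j) = {}"
proof -
  have "k mod 2 ^ j = k mod 2 ^ Suc j \<or> k mod 2 ^ j + 2 ^ j = k mod 2 ^ Suc j" for k :: nat
  proof -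
    have "k mod 2 ^ Suc j = 2 ^ j * (k div 2 ^ j mod 2) + k mod 2 ^ j"
      by (metis mod_mult2_eq power_Suc2)
    moreover have "k div 2 ^ j mod 2 = 0 \<or> k div 2 ^ j mod 2 = 1" by auto
    ultimately show ?thesis by auto
  qed
  moreover have "k mod 2 ^ j = a" if "k mod 2 ^ Suc j = a \<or> k mod 2 ^ Suc j = a + 2 ^ j" for k
  proof -
    have "k mod 2 ^ Suc j mod 2 ^ j = k mod 2 ^ j" by (simp add: mod_mod_cancel)
    moreover have "k mod 2 ^ Suc j mod 2 ^ j = a"
      using that assms by (elim disjE) (simp_all only: mod_add_self2 mod_less)
    ultimately show ?thesis by simp
  qed
  ultimately show "residue j a = residue (Suc j) a \<union> residue (Suc j) (a + 2 ^ j)"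
    unfolding residue_def set_eq_iff Un_iff mem_Collect_eq by metis
  show "residue (Suc j) a \<inter> residue (Suc j) (a + 2 ^ j) = {}"
    by (auto simp: residue_def)
qed

lemma prob_Un_UN_le:
  assumes "X \<subseteq> S \<union> (\<Union>i\<in>I. R i)" "finite I"
  shows "measure_pmf.prob p X \<le> measure_pmf.prob p S + (\<Sum>i\<in>I. measure_pmf.prob p (R i))"
proof -
  have "measure_pmf.prob p X \<le> measure_pmf.prob p (S \<union> (\<Union>i\<in>I. R i))"
    using assms by (intro measure_pmf.finite_measure_mono) auto
  also have "\<dots> \<le> measure_pmf.prob p S + measure_pmf.prob p (\<Union>i\<in>I. R i)"
    by (rule measure_Un_le) auto
  also have "measure_pmf.prob p (\<Union>i\<in>I. R i) \<le> (\<Sum>i\<in>I. measure_pmf.prob p (R i))"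
    using assms by (intro measure_pmf.finite_measure_subadditive_finite) auto
  finally show ?thesis by simp
qed

definition phase_end :: "real \<Rightarrow> nat \<Rightarrow> nat \<Rightarrow> nat" where
  "phase_end d j n = nat \<lfloor>real j * d * real n\<rfloor>"

lemma phase_end_step:
  fixes d :: real
  assumes d: "d < t" and t: "0 < t"
  shows "phase_end d j n \<le> phase_end d (Suc j) n"
    and "eventually (\<lambda>n. real (phase_end d (Suc j) n - phase_end d j n) \<le> t * (real n - 1)) sequentially"
    and "real (phase_end d j n) \<le> real j * t * real n"
proof -
  \<comment> \<open>The constant for two colours may be negative, and \<open>nat\<close> then makes
    every phase empty.\<close>
  have neg: "phase_end d j n = 0" if "d < 0" for j n
  proof -
    have "real j * d * real n \<le> 0" using that by (simp add: mult_nonneg_nonpos mult_nonpos_nonneg)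
    then have "\<lfloor>real j * d * real n\<rfloor> \<le> 0" by linarith
    then show ?thesis by (simp add: phase_end_def)
  qed
  show "phase_end d j n \<le> phase_end d (Suc j) n"
  proof (cases "d < 0")
    case False
    then show ?thesis unfolding phase_end_def
      by (intro nat_mono floor_mono mult_right_mono) auto
  qed (simp add: neg)
  show "real (phase_end d j n) \<le> real j * t * real n"
  proof (cases "d < 0")
    case False
    then have "real (phase_end d j n) \<le> real j * d * real n" unfolding phase_end_def by simp
    also have "\<dots> \<le> real j * t * real n" using d by (intro mult_right_mono mult_left_mono) auto
    finally show ?thesis .
  qed (use t in \<open>simp add: neg\<close>)
  show "eventually (\<lambda>n. real (phase_end d (Suc j) n - phase_end d j n) \<le> t * (real n - 1)) sequentially"
  proof -
    \<comment> \<open>The gap between \<open>d\<close> and \<open>t\<close> absorbs the rounding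
      error 1 and the \<open>t\<close> lost by writing n - 1 for n.\<close>
    have "filterlim (\<lambda>n. (t - d) * real n) at_top sequentially" using d by real_asymp
    then have "eventually (\<lambda>n. 1 + t \<le> (t - d) * real n) sequentially"
      by (simp add: filterlim_at_top)
    then show ?thesis using eventually_ge_at_top[of "1::nat"]
    proof eventually_elim
      case (elim n)
      show ?case
      proof (cases "d < 0")
        case True
        then show ?thesis using t elim by (simp add: neg)
      next
        case False
        then have "real (phase_end d (Suc j) n) \<le> real (Suc j) * d * real n" unfolding phase_end_def by simp
        moreover have "real (phase_end d j n) \<ge> real j * d * real n - 1" unfolding phase_end_def by linarith
        moreover have "real (Suc j) * d * real n = real j * d * real n + d * real n"
          by (simp add: algebra_simps)
        ultimately have "real (phase_end d (Suc j) n) - real (phase_end d j n) \<le> t * (real n - 1)"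
          using elim by (simp add: algebra_simps)
        moreover have "0 \<le> t * (real n - 1)" using t elim by simp
        ultimately show ?thesis by (cases "phase_end d j n \<le> phase_end d (Suc j) n") auto
      qed
    qed
  qed
qed

text \<open>If no class is good at the end, then none was good at the start or one of the
  \<open>2 ^ j\<close> classes turned from good to bad. The union bound avoids choosing a class that
  depends on the history.\<close>

lemma residue_phase_whp:
  fixes s \<sigma> d t \<beta> Y :: real
  assumes d: "d < t" and t: "0 < t" and s: "0 \<le> s" "s < \<sigma>" "2 * t * \<sigma> < 1" and pos: "0 < \<beta>" "0 < Y"
  assumes start: "\<And>A :: nat \<Rightarrow> algorithm. (\<lambda>n. measure_pmf.prob (coloured_process n (A n) (phase_end d j n))
       {h. \<forall>a<2^j. \<not> good n (residue j a) \<beta> Y s h}) \<longlonglongrightarrow> 0"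
  shows "\<exists>\<beta>'>0. \<exists>Y'>0. \<forall>A :: nat \<Rightarrow> algorithm.
    (\<lambda>n. measure_pmf.prob (coloured_process n (A n) (phase_end d (Suc j) n))
       {h. \<forall>a<2^j. \<not> good n (residue j a) \<beta>' Y' (\<sigma> / (1 - 2 * t * \<sigma>)) h}) \<longlonglongrightarrow> 0"
proof -
  let ?s = "\<sigma> / (1 - 2 * t * \<sigma>)"
  note m_mono = phase_end_step(1)[OF d t]
    and m_step = phase_end_step(2)[OF d t]
  obtain \<beta>' Y' where new: "0 < \<beta>'" "0 < Y'" "\<forall>A :: nat \<Rightarrow> algorithm. \<forall>M.
    (\<lambda>n. measure_pmf.prob (coloured_process n (A n) (phase_end d (Suc j) n))
      {h. good n M \<beta> Y s (take (phase_end d j n) h) \<and> \<not> good n M \<beta>' Y' ?s h}) \<longlonglongrightarrow> 0"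
    using phase_whp[OF pos(1) less_imp_le[OF pos(2)] s(1,2) t s(3) m_mono[of j] m_step[of j]]
    by (elim exE conjE) (rule that, assumption+)
  show ?thesis
  proof (rule ex_pos_pairI[OF new(1,2)], intro allI)
    fix A :: "nat \<Rightarrow> algorithm"
    let ?P = "\<lambda>n. coloured_process n (A n) (phase_end d (Suc j) n)"
    define S1 where "S1 n = {h. \<forall>a<2^j. \<not> good n (residue j a) \<beta> Y s (take (phase_end d j n) h)}" for n
    define S2 where "S2 n a = {h. good n (residue j a) \<beta> Y s (take (phase_end d j n) h) \<and>
      \<not> good n (residue j a) \<beta>' Y' ?s h}" for n a
    have "(\<lambda>n. measure_pmf.prob (?P n) (S1 n)) \<longlonglongrightarrow> 0"
    proof (rule Lim_transform_eventually[OF start[of A]])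
      show "eventually (\<lambda>n. measure_pmf.prob (coloured_process n (A n) (phase_end d j n))
          {h. \<forall>a<2^j. \<not> good n (residue j a) \<beta> Y s h} = measure_pmf.prob (?P n) (S1 n)) sequentially"
        using eventually_ge_at_top[of "2::nat"]
      proof eventually_elim
        case (elim n)
        show ?case
          by (subst take_process[OF elim m_mono[of j], symmetric]) (simp add: S1_def vimage_def)
      qed
    qed
    moreover have "(\<lambda>n. \<Sum>a<2^j. measure_pmf.prob (?P n) (S2 n a)) \<longlonglongrightarrow> 0"
      unfolding S2_def by (rule tendsto_null_sum) (rule new(3)[rule_format])
    ultimately have lim: "(\<lambda>n. measure_pmf.prob (?P n) (S1 n) +
        (\<Sum>a<2^j. measure_pmf.prob (?P n) (S2 n a))) \<longlonglongrightarrow> 0"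
      by (rule tendsto_add_zero)
    have "{h. \<forall>a<2^j. \<not> good n (residue j a) \<beta>' Y' ?s h} \<subseteq> S1 n \<union> (\<Union>a\<in>{..<2^j}. S2 n a)" for n
      by (auto simp: S1_def S2_def)
    then have bound: "measure_pmf.prob (?P n) {h. \<forall>a<2^j. \<not> good n (residue j a) \<beta>' Y' ?s h} \<le>
        measure_pmf.prob (?P n) (S1 n) + (\<Sum>a<2^j. measure_pmf.prob (?P n) (S2 n a))" for n
      by (rule prob_Un_UN_le) simp
    show "(\<lambda>n. measure_pmf.prob (?P n)
        {h. \<forall>a<2^j. \<not> good n (residue j a) \<beta>' Y' ?s h}) \<longlonglongrightarrow> 0"
      by (rule tendsto_zero_probI[OF _ lim]) (use bound in simp)
  qed
qed

text \<open>Of the two halves of a group with mean component size \<open>s\<close> at the end of a phase, one has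
  mean component size at most about \<open>(1 + s) / 2\<close>. Halving the group after every phase but the
  last leaves a single residue class modulo \<open>2 ^ p\<close>.\<close>

lemma some_residue_good:
  fixes s \<sigma> :: "nat \<Rightarrow> real" and d t :: real
  assumes d: "d < t" and t: "0 < t" and s0: "1 \<le> s 0"
    and step: "\<And>j. j \<le> p \<Longrightarrow> 0 \<le> s j \<and> s j < \<sigma> j \<and> 2 * t * \<sigma> j < 1"
    and halve: "\<And>j. j < p \<Longrightarrow> (1 + \<sigma> j / (1 - 2 * t * \<sigma> j)) / 2 < s (Suc j)"
  assumes jp: "j \<le> p"
  shows "\<exists>\<beta>>0. \<exists>Y>0. \<forall>A :: nat \<Rightarrow> algorithm.
    (\<lambda>n. measure_pmf.prob (coloured_process n (A n) (phase_end d j n))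
       {h. \<forall>a<2^j. \<not> good n (residue j a) \<beta> Y (s j) h}) \<longlonglongrightarrow> 0"
  using jp
proof (induction j)
  case 0
  \<comment> \<open>In the empty graph every component is a single vertex, with mean 1 and moment
    exp 1 - 1.\<close>
  have "good n (residue 0 0) 1 (exp 1) (s 0) []" for n
  proof -
    have "csize [] M w = 1" for M w
      by (simp add: csize_def component_def group_adj_def)
    then show ?thesis using s0 mult_left_mono[OF s0, of "real n"]
        mult_left_mono[of "exp 1 - 1" "exp 1 :: real" "real n"]
      by (simp add: good_def csum_def expm_def)
  qed
  then show ?case
    by (intro ex_pos_pairI[of 1 "exp 1"]) (auto simp: phase_end_def)
next
  case (Suc j)
  from Suc.IH[OF Suc_leD[OF Suc.prems]]
  obtain \<beta> Y where IH: "0 < \<beta>" "0 < Y" "\<forall>A :: nat \<Rightarrow> algorithm.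
    (\<lambda>n. measure_pmf.prob (coloured_process n (A n) (phase_end d j n))
       {h. \<forall>a<2^j. \<not> good n (residue j a) \<beta> Y (s j) h}) \<longlonglongrightarrow> 0"
    by (elim exE conjE) (rule that, assumption+)
  define s' where "s' = \<sigma> j / (1 - 2 * t * \<sigma> j)"
  have j: "0 \<le> s j" "s j < \<sigma> j" "2 * t * \<sigma> j < 1" "(1 + s') / 2 < s (Suc j)"
    using step[of j] halve[of j] Suc.prems by (auto simp: s'_def)
  note m_le = phase_end_step(3)[OF d t]
  obtain \<beta>' Y' where new: "0 < \<beta>'" "0 < Y'" "\<forall>A :: nat \<Rightarrow> algorithm.
    (\<lambda>n. measure_pmf.prob (coloured_process n (A n) (phase_end d (Suc j) n))
       {h. \<forall>a<2^j. \<not> good n (residue j a) \<beta>' Y' s' h}) \<longlonglongrightarrow> 0"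
    using residue_phase_whp[OF d t j(1-3) IH(1,2) IH(3)[rule_format]]
    unfolding s'_def[symmetric] by (elim exE conjE) (rule that, assumption+)
  show ?case
  proof (rule ex_pos_pairI[OF new(1,2)], intro allI)
    fix A :: "nat \<Rightarrow> algorithm"
    let ?P = "\<lambda>n. coloured_process n (A n) (phase_end d (Suc j) n)"
    define S1 where "S1 n = {h. \<forall>a<2^j. \<not> good n (residue j a) \<beta>' Y' s' h}" for n
    define S2 where "S2 n a = {h. good n (residue j a) \<beta>' Y' s' h \<and>
      \<not> good n (residue (Suc j) a) \<beta>' Y' (s (Suc j)) h \<and>
      \<not> good n (residue (Suc j) (a + 2 ^ j)) \<beta>' Y' (s (Suc j)) h}" for n a
    have "(\<lambda>n. measure_pmf.prob (?P n) (S1 n)) \<longlonglongrightarrow> 0"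
      unfolding S1_def by (rule new(3)[rule_format])
    moreover have "(\<lambda>n. \<Sum>a<2^j. measure_pmf.prob (?P n) (S2 n a)) \<longlonglongrightarrow> 0"
    proof (rule tendsto_null_sum)
      fix a :: nat assume "a \<in> {..<2^j}"
      then have a: "a < 2 ^ j" by simp
      show "(\<lambda>n. measure_pmf.prob (?P n) (S2 n a)) \<longlonglongrightarrow> 0"
        unfolding S2_def residue_split(1)[OF a]
        by (rule split_whp[OF new(1,2) j(4) residue_split(2)[OF a]])
          (rule always_eventually, rule allI, rule m_le)
    qed
    ultimately have lim: "(\<lambda>n. measure_pmf.prob (?P n) (S1 n) +
        (\<Sum>a<2^j. measure_pmf.prob (?P n) (S2 n a))) \<longlonglongrightarrow> 0"
      by (rule tendsto_add_zero)
    have "{h. \<forall>a<2^Suc j. \<not> good n (residue (Suc j) a) \<beta>' Y' (s (Suc j)) h} \<subseteq>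
        S1 n \<union> (\<Union>a\<in>{..<2^j}. S2 n a)" for n
    proof
      fix h assume h: "h \<in> {h. \<forall>a<2^Suc j. \<not> good n (residue (Suc j) a) \<beta>' Y' (s (Suc j)) h}"
      have "h \<in> S2 n a" if "a < 2^j" "good n (residue j a) \<beta>' Y' s' h" for a
        using h that by (simp add: S2_def)
      then show "h \<in> S1 n \<union> (\<Union>a\<in>{..<2^j}. S2 n a)" unfolding S1_def by blast
    qed
    then have bound: "measure_pmf.prob (?P n) {h. \<forall>a<2^Suc j. \<not> good n (residue (Suc j) a) \<beta>' Y' (s (Suc j)) h} \<le>
        measure_pmf.prob (?P n) (S1 n) + (\<Sum>a<2^j. measure_pmf.prob (?P n) (S2 n a))" for n
      by (rule prob_Un_UN_le) simp
    show "(\<lambda>n. measure_pmf.prob (?P n)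
        {h. \<forall>a<2^Suc j. \<not> good n (residue (Suc j) a) \<beta>' Y' (s (Suc j)) h}) \<longlonglongrightarrow> 0"
      by (rule tendsto_zero_probI[OF _ lim]) (use bound in simp)
  qed
qed

section \<open>From residue classes to a single colour\<close>

text \<open>The witness is the colour \<open>a\<close> itself: it lies in its own residue class and
  is admissible because a < 2^p \<le> r.\<close>

lemma good_some_colour_small:
  assumes n: "n \<ge> 2" and h: "h \<in> set_pmf (coloured_process n A T)"
    and a: "a < 2 ^ p" "2 ^ p \<le> r" and g: "good n (residue p a) \<beta> Y s h" "0 < \<beta>" "0 < Y"
    and x: "ln (1 + real n * Y) / \<beta> \<le> x"
  shows "some_colour_small n r x h"
proof -
  have val: "valid_history n h" using set_pmf_process[OF n h] by simp
  have adj: "colour_adj h a = group_adj h {a}" by (auto simp: colour_adj_def group_adj_def)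
  have "real (card C) \<le> x" if C: "C \<in> colour_components n h a" for C
  proof -
    obtain v where v: "v < n" "C = component (group_adj h {a}) v"
      using C by (auto simp: colour_components_def adj component_def)
    have "csize h {a} v \<le> csize h (residue p a) v"
      using v(1) a by (intro csize_mono[OF val]) (auto simp: residue_def)
    then have "real (card C) \<le> real (csize h (residue p a) v)" by (simp add: v(2) csize_def)
    also have "\<dots> \<le> x" using good_csize_le[OF g v(1)] x by simp
    finally show ?thesis .
  qed
  then show ?thesis using a unfolding some_colour_small_def by (intro exI[of _ a]) auto
qed

text \<open>\<open>s j\<close> bounds the mean at the start of phase \<open>j\<close> and
  \<open>\<sigma> j\<close> adds slack. The last phase is followed by no halving, so
  \<open>p\<close> halvings allow \<open>p + 1\<close> phases of \<open>d * n\<close>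
  rounds.\<close>

lemma whp_small_colour_afterI:
  fixes s \<sigma> :: "nat \<Rightarrow> real" and d t :: real
  assumes d: "d < t" and t: "0 < t" and s0: "1 \<le> s 0"
    and step: "\<And>j. j \<le> p \<Longrightarrow> 0 \<le> s j \<and> s j < \<sigma> j \<and> 2 * t * \<sigma> j < 1"
    and halve: "\<And>j. j < p \<Longrightarrow> (1 + \<sigma> j / (1 - 2 * t * \<sigma> j)) / 2 < s (Suc j)"
    and p: "2 ^ p \<le> r" and \<tau>: "\<tau> = real (Suc p) * d"
  shows "whp_small_colour_after r \<tau>"
proof -
  have "\<exists>\<beta>>0. \<exists>Y>0. \<forall>A :: nat \<Rightarrow> algorithm.
    (\<lambda>n. measure_pmf.prob (coloured_process n (A n) (phase_end d p n))
       {h. \<forall>a<2^p. \<not> good n (residue p a) \<beta> Y (s p) h}) \<longlonglongrightarrow> 0"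
    by (rule some_residue_good[where s = s and \<sigma> = \<sigma> and p = p, OF d t s0])
       (erule step, erule halve, rule order_refl)
  then obtain \<beta>0 Y0 where start: "0 < \<beta>0" "0 < Y0" "\<forall>A :: nat \<Rightarrow> algorithm.
    (\<lambda>n. measure_pmf.prob (coloured_process n (A n) (phase_end d p n))
       {h. \<forall>a<2^p. \<not> good n (residue p a) \<beta>0 Y0 (s p) h}) \<longlonglongrightarrow> 0"
    by (elim exE conjE) (rule that, assumption+)
  have sp: "0 \<le> s p" "s p < \<sigma> p" "2 * t * \<sigma> p < 1" using step[of p] by simp_all
  define s' where "s' = \<sigma> p / (1 - 2 * t * \<sigma> p)"
  obtain \<beta> Y where good: "0 < \<beta>" "0 < Y" "\<forall>A :: nat \<Rightarrow> algorithm.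
    (\<lambda>n. measure_pmf.prob (coloured_process n (A n) (nat \<lfloor>\<tau> * real n\<rfloor>))
       {h. \<forall>a<2^p. \<not> good n (residue p a) \<beta> Y s' h}) \<longlonglongrightarrow> 0"
    using residue_phase_whp[OF d t sp start(1,2) start(3)[rule_format]]
    unfolding phase_end_def \<tau>[symmetric] s'_def[symmetric]
    by (elim exE conjE) (rule that, assumption+)
  \<comment> \<open>The factor 2 absorbs \<open>Y\<close>, since 1 + n Y is eventually below n^2.
    \<open>K\<close> depends on \<beta> only, which is fixed before the algorithm.\<close>
  define K where "K = 2 / \<beta>"
  have "eventually (\<lambda>n. ln (1 + real n * Y) \<le> 2 * ln (real n)) sequentially"
    using good(2) by real_asymp
  then have K: "eventually (\<lambda>n. ln (1 + real n * Y) / \<beta> \<le> K * ln (real n)) sequentially"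
    by eventually_elim (use good(1) in \<open>simp add: K_def field_simps\<close>)
  have "(\<lambda>n. measure_pmf.prob (coloured_process n (A n) (nat \<lfloor>\<tau> * real n\<rfloor>))
      {h. some_colour_small n r (K * ln (real n)) h}) \<longlonglongrightarrow> 1" for A :: "nat \<Rightarrow> algorithm"
  proof (rule tendsto_sandwich[OF _ _ _ tendsto_const])
    let ?P = "\<lambda>n. coloured_process n (A n) (nat \<lfloor>\<tau> * real n\<rfloor>)"
    let ?bad = "\<lambda>n. {h. \<forall>a<2^p. \<not> good n (residue p a) \<beta> Y s' h}"
    show "(\<lambda>n. 1 - measure_pmf.prob (?P n) (?bad n)) \<longlonglongrightarrow> 1"
      using tendsto_diff[OF tendsto_const good(3)[rule_format], of 1 A] by simp
    show "eventually (\<lambda>n. 1 - measure_pmf.prob (?P n) (?bad n) \<le>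
        measure_pmf.prob (?P n) {h. some_colour_small n r (K * ln (real n)) h}) sequentially"
      using K eventually_ge_at_top[of "2::nat"]
    proof eventually_elim
      case (elim n)
      have "1 - measure_pmf.prob (?P n) (?bad n) = measure_pmf.prob (?P n) (- ?bad n)"
        using measure_pmf.prob_compl[of "?bad n" "?P n"] by (simp add: Compl_eq_Diff_UNIV)
      also have "\<dots> \<le> measure_pmf.prob (?P n) {h. some_colour_small n r (K * ln (real n)) h}"
      proof (rule measure_pmf.finite_measure_mono_AE)
        have "some_colour_small n r (K * ln (real n)) h"
          if "h \<in> set_pmf (?P n)" "a < 2 ^ p" "good n (residue p a) \<beta> Y s' h" for h a
          by (rule good_some_colour_small[OF elim(2) that(1,2) p that(3) good(1,2) elim(1)])
        then show "AE h in ?P n. h \<in> - ?bad n \<longrightarrow> h \<in> {h. some_colour_small n r (K * ln (real n)) h}"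
          by (auto simp: AE_measure_pmf_iff)
      qed simp
      finally show ?case .
    qed
  qed auto
  then show ?thesis unfolding whp_small_colour_after_def by (intro exI[of _ K] allI impI)
qed

section \<open>Numerical parameters\<close>

text \<open>Rounding \<open>log 2 r\<close> down to the number of phases can halve it, so the constant is about half the
  greatest possible phase length \<open>(3 - 2 sqrt 2) / 2\<close>.\<close>

lemma whp_small_colour_log:
  fixes r :: nat
  assumes "r \<ge> 2"
  shows "whp_small_colour_after r (0.0427 * log 2 (real r))"
proof -
  define q where "q = nat \<lfloor>log 2 (real r)\<rfloor>"
  have "1 \<le> log 2 (real r)" using assms by (simp add: le_log_iff)
  then have q: "1 \<le> q" "real q \<le> log 2 (real r)" "log 2 (real r) < real q + 1"
    unfolding q_def by linarith+
  have "2 powr real q \<le> real r" using q assms by (simp add: le_log_iff)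
  then have "real (2 ^ q) \<le> real r" by (simp add: powr_realpow)
  then have "2 ^ q \<le> r" by (simp only: of_nat_le_iff)
  moreover have "(2::nat) ^ (q - 1) \<le> 2 ^ q" by (intro power_increasing) auto
  ultimately have r: "2 ^ (q - 1) \<le> r" by linarith
  show ?thesis
  \<comment> \<open>At the critical phase length the fixed point is 1 + sqrt 2 / 2 = 1.7071...; at t
    = 0.0855 the value 1.71 is mapped to about 1.7083, just below 1.709, so constant sequences
    suffice.\<close>
  proof (rule whp_small_colour_afterI[where s = "\<lambda>_. 1.709" and \<sigma> = "\<lambda>_. 1.71" and t = "0.0855",
        OF _ _ _ _ _ r])
    \<comment> \<open>log 2 r < q + 1 \<le> 2 q, so each phase is shorter than 2 * 0.0427 =
      0.0854.\<close>
    show "0.0427 * log 2 (real r) / real q < 0.0855" using q by (simp add: field_simps)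
    show "0.0427 * log 2 (real r) = real (Suc (q - 1)) * (0.0427 * log 2 (real r) / real q)"
      using q by simp
  qed simp_all
qed

text \<open>The first phase takes the mean from 1 to 1 / (1 - 2 t), and halving gives
  \<open>F 1\<close> = (1 - t) / (1 - 2 t). The second phase needs 2 t F(1) < 1, that is (1 - t)^2 >
  1/2, or t < 1 - sqrt 2 / 2.\<close>

lemma whp_small_colour_two:
  fixes c :: real
  assumes "c < 2 - sqrt 2"
  shows "whp_small_colour_after 2 c"
proof -
  have sq: "1 < sqrt 2" "sqrt 2 < 2" by (simp_all add: real_less_lsqrt)
  obtain t where t: "max 0 (c / 2) < t" "t < 1 - sqrt 2 / 2"
    using dense[of "max 0 (c / 2)" "1 - sqrt 2 / 2"] assms sq by auto
  have "0 < t" using t(1) by simp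
  moreover have "t < 1 / 2" using t(2) sq(1) by linarith
  ultimately have t12: "0 < t" "t < 1 / 2" by blast+
  have "(sqrt 2 / 2)\<^sup>2 < (1 - t)\<^sup>2" using t by (intro power_strict_mono) auto
  then have t2: "1/2 < (1 - t)\<^sup>2" by (simp add: power_divide)
  define F where "F x = (1 + x / (1 - 2 * t * x)) / 2" for x
  have F1: "2 * t * F 1 < 1" using t2 t12 by (simp add: F_def field_simps power2_eq_square)
  \<comment> \<open>The starting mean is exactly 1, but the phase needs a strictly larger
    \<open>x\<close>; continuity keeps the second condition true for \<open>x\<close> slightly above
    1.\<close>
  have "isCont F 1" unfolding F_def using t12 by (intro continuous_intros) auto
  then have "(F \<longlongrightarrow> F 1) (at_right 1)"
    by (simp add: isCont_def filterlim_at_split)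
  then have l1: "((\<lambda>x. 2 * t * F x) \<longlongrightarrow> 2 * t * F 1) (at_right 1)" by (intro tendsto_intros)
  have l2: "((\<lambda>x. 2 * t * x) \<longlongrightarrow> 2 * t * 1) (at_right 1)" by (intro tendsto_intros)
  have "eventually (\<lambda>x. 2 * t * x < 1) (at_right 1)"
    by (rule order_tendstoD(2)[OF l2]) (use t12 in simp)
  with order_tendstoD(2)[OF l1 F1] eventually_at_right_less[of "1::real"]
  have "eventually (\<lambda>x. 2 * t * F x < 1 \<and> 2 * t * x < 1 \<and> 1 < x) (at_right 1)"
    by eventually_elim simp
  then obtain x where x: "2 * t * F x < 1" "2 * t * x < 1" "1 < x"
    using eventually_happens by fastforce
  have "F x < 1 / (2 * t)" using x t12 by (simp add: field_simps)
  then obtain z where z: "F x < z" "z < 1 / (2 * t)" using dense by blast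
  then obtain w where w: "z < w" "w < 1 / (2 * t)" using dense by blast
  have Fx: "0 \<le> F x" using x t12 by (auto simp: F_def)
  show ?thesis
  proof (rule whp_small_colour_afterI[where s = "\<lambda>j. if j = 0 then 1 else z" and
        \<sigma> = "\<lambda>j. if j = 0 then x else w" and t = t and p = 1 and d = "c / 2"])
    show "0 \<le> (if j = 0 then 1 else z) \<and> (if j = 0 then 1 else z) < (if j = 0 then x else w) \<and>
        2 * t * (if j = 0 then x else w) < 1" for j :: nat
      using x w z Fx t12 by (auto simp: field_simps)
    show "(1 + (if j = 0 then x else w) / (1 - 2 * t * (if j = 0 then x else w))) / 2 <
        (if Suc j = 0 then 1 else z)" if "j < 1" for j :: nat
      using that z by (simp add: F_def)
  qed (use t in auto)
qed

theorem theorem1p4: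
  "(\<exists>c::real. c > 0 \<and> \<bar>c - 0.043\<bar> \<le> 0.0005 \<and>
      (\<forall>r::nat. r \<ge> 2 \<longrightarrow> whp_small_colour_after r (c * log 2 (real r)))) \<and>
   (\<forall>c'::real. c' < 2 - sqrt 2 \<longrightarrow> whp_small_colour_after 2 c')"
\<comment> \<open>Half of the critical phase length is (3 - 2 sqrt 2) / 4 = 0.04289...; 0.0427 lies
  below it and within 0.0005 of 0.043.\<close>
proof (intro conjI exI[of _ "0.0427 :: real"] allI impI)
  fix r :: nat assume "2 \<le> r"
  then show "whp_small_colour_after r (0.0427 * log 2 (real r))" by (rule whp_small_colour_log)
next
  fix c' :: real assume "c' < 2 - sqrt 2"
  then show "whp_small_colour_after 2 c'" by (rule whp_small_colour_two)
qed simp_all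

end
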